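(* Consider the generalized time-dependent Pólya urn process $(R_n,B_n)_{n\ge0}$ with non-decreasing weight function $w:\mathbb N\to(0,\infty)$, drawing sequence $(\sigma_n)_{n\ge1}$ of positive integers, and initial numbers $R_0,B_0\in\mathbb N$ of red and blue balls. Assume that $(\sigma_n)_{n\ge1}$ is bounded. Then the following three conditions are equivalent: $$\sum_{k\ge1}\frac1{w(k)}<\infty\ \Longleftrightarrow\ \mathbb P(R_\infty<\infty)>0\ \Longleftrightarrow\ \mathbb P(R_\infty<\infty\text{ or }B_\infty<\infty)=1.$$
   Context: $\mathbb N=\{0,1,2,\dots\}$. Generalized time-dependent Pólya urn (GPU) process: fix a non-decreasing $w:\mathbb N\to(0,\infty)$ and a sequence $(\sigma_n)_{n\ge1}$ of positive integers. The urn initially contains $R_0$ red and $B_0$ blue balls. At step $n+1$ ($n\ge0$), $\sigma_{n+1}$ new balls are added simultaneously, each being, independently, red with probability $\frac{w(R_n)}{w(R_n)+w(B_n)}$ and blue otherwise, where $R_n,B_n$ are the numbers of red and blue balls after $n$ steps. That is, conditionally on the past up to step $n$, $R_{n+1}-R_n$ is Binomial with parameters $\sigma_{n+1}$ and $\frac{w(R_n)}{w(R_n)+w(B_n)}$, and $B_{n+1}-B_n=\sigma_{n+1}-(R_{n+1}-R_n)$. Set $R_\infty=\lim_n R_n$ and $B_\infty=\lim_n B_n$ in $\mathbb N\cup\{\infty\}$. *)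

theory Defs
  imports "HOL-Probability.Probability"
begin

text \<open>
  The process is described by its law: a locale instance is any realisation of the urn on any
  probability space. The past up to step \<open>n\<close> is the whole history of both colours; since it takes
  countably many values, conditioning on it is elementary conditioning on the histories of positive
  probability. The sequence \<open>\<sigma>\<close> is indexed from 1, and \<open>\<sigma> 0\<close> plays no role. The increment condition
  is phrased additively because subtraction on \<open>nat\<close> truncates; since the binomial probabilities sum
  to 1, it implies that \<open>R\<close> is almost surely non-decreasing.
\<close>

locale gpu_process = prob_space M for M :: "'a measure" +
  fixes w :: "nat \<Rightarrow> real" and \<sigma> :: "nat \<Rightarrow> nat" and r\<^sub>0 b\<^sub>0 :: nat
    and R B :: "nat \<Rightarrow> 'a \<Rightarrow> nat"
  assumes R_measurable: "\<And>n. R n \<in> measurable M (count_space UNIV)"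
    and B_measurable: "\<And>n. B n \<in> measurable M (count_space UNIV)"
    and R_initial: "AE \<omega> in M. R 0 \<omega> = r\<^sub>0"
    and B_initial: "AE \<omega> in M. B 0 \<omega> = b\<^sub>0"
    and R_step: "\<And>n r b k. \<P>(\<omega> in M. \<forall>i\<le>n. R i \<omega> = r i \<and> B i \<omega> = b i) > 0 \<Longrightarrow>
        \<P>(\<omega> in M. R (Suc n) \<omega> = R n \<omega> + k \<bar> \<forall>i\<le>n. R i \<omega> = r i \<and> B i \<omega> = b i) =
        pmf (binomial_pmf (\<sigma> (Suc n)) (w (r n) / (w (r n) + w (b n)))) k"
    and total_step: "\<And>n. AE \<omega> in M. R (Suc n) \<omega> + B (Suc n) \<omega> = R n \<omega> + B n \<omega> + \<sigma> (Suc n)"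

definition limit_count :: "(nat \<Rightarrow> 'a \<Rightarrow> nat) \<Rightarrow> 'a \<Rightarrow> enat" where
  "limit_count X \<omega> = lim (\<lambda>n. enat (X n \<omega>))"

end

theory Submission
  imports Defs
begin

text \<open>
  If the series diverges, the conditional probability that red never grows again after a given
  history is an infinite product that vanishes. If it converges, this product is positive, and it
  remains to exclude that both colours become infinite. Adding \<open>1 / w R\<close> for each red ball and
  subtracting \<open>1 / w B\<close> for each blue one defines a martingale. On the event \<open>A\<close> that both colours
  become infinite its limit is determined up to an error \<open>O(\<delta>)\<close>, where \<open>\<delta> = 1 / w (min R\<^sub>0 B\<^sub>0)\<close>,
  while its quadratic variation is at least \<open>V\<close>, the sum of \<open>1 / (w k)\<^sup>2\<close> over \<open>k \<ge> R\<^sub>0\<close> plus that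
  over \<open>k \<ge> B\<^sub>0\<close>. Comparing second and fourth moments shows that \<open>A\<close> cannot be nearly certain
  when \<open>V\<close> is large compared with \<open>\<delta>\<^sup>2\<close>. If \<open>A\<close> had positive probability, it would be nearly
  certain after suitable histories that end when \<open>min R B\<close> first reaches any given high level; hence
  the tails of the sum of \<open>1 / (w k)\<^sup>2\<close> would be comparable to their first terms, so \<open>1 / w\<close> would
  decay geometrically. But then the product above is bounded away from 0, so that \<open>A\<close> is never
  nearly certain.
\<close>

section \<open>Sums along increasing sequences and binomial averages\<close>

text \<open>Since \<open>w\<close> is only assumed monotone, no growth rate is available; it is
  replaced by the alternative between V large against \<delta>^2 and V comparable to \<delta>^2. The
  error O(\<delta>) is due to the batches: all balls of a batch use the counts before it, so a
  colour that passes several integers at once adds \<open>1 / w\<close> at the first of them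
  repeatedly. With single balls the limit on \<open>A\<close> would be exactly the difference of the
  two series. Second moments alone cannot exclude that the variance comes from a rare event outside
  \<open>A\<close>; the fourth moment limits what such an event contributes.

  Conditioning on a history restarts an urn with the same \<open>w\<close> and the same bound on the
  batches, so the estimates are made to depend only on these and on the starting counts. Geometric
  decay needs the tail estimate at each large k and not just along a sequence, which is why the
  histories must end close to any prescribed level.\<close>

lemma sum_increments_bounds:
  fixes f :: "nat \<Rightarrow> real" and X :: "nat \<Rightarrow> nat"
  assumes f: "\<And>i j. i \<le> j \<Longrightarrow> f j \<le> f i"
    and X: "\<And>m. X m \<le> X (Suc m)" "\<And>m. X (Suc m) \<le> X m + S"
  shows "sum f {X 0..<X n} \<le> (\<Sum>m<n. (real (X (Suc m)) - real (X m)) * f (X m))"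
    and "(\<Sum>m<n. (real (X (Suc m)) - real (X m)) * f (X m))
           \<le> sum f {X 0..<X n} + real S * (f (X 0) - f (X n))"
proof -
  have "sum f {X 0..<X n} \<le> (\<Sum>m<n. (real (X (Suc m)) - real (X m)) * f (X m)) \<and>
        (\<Sum>m<n. (real (X (Suc m)) - real (X m)) * f (X m))
           \<le> sum f {X 0..<X n} + real S * (f (X 0) - f (X n))"
  proof (induction n)
    case 0
    then show ?case by simp
  next
    case (Suc n)
    define d where "d = real (X (Suc n)) - real (X n)"
    have d: "0 \<le> d" "d \<le> real S" using X[of n] by (auto simp: d_def)
    have le0: "X 0 \<le> X n" using X(1) lift_Suc_mono_le[of X 0 n] by simp
    have split: "sum f {X 0..<X (Suc n)} = sum f {X 0..<X n} + sum f {X n..<X (Suc n)}"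
      using le0 X(1)[of n] by (simp add: sum.atLeastLessThan_concat)
    have c: "real (card {X n..<X (Suc n)}) = d" using X(1)[of n] by (simp add: d_def)
    have up: "sum f {X n..<X (Suc n)} \<le> d * f (X n)"
      using sum_bounded_above[of "{X n..<X (Suc n)}" f "f (X n)"] f c by auto
    have lo: "d * f (X (Suc n)) \<le> sum f {X n..<X (Suc n)}"
      using sum_bounded_below[of "{X n..<X (Suc n)}" "f (X (Suc n))" f] f c by auto
    \<comment> \<open>Freezing f over a jump overcounts by at most S times the drop of f; these
      drops telescope to \<open>f (X 0) - f (X n)\<close>.\<close>
    have "d * (f (X n) - f (X (Suc n))) \<le> real S * (f (X n) - f (X (Suc n)))"
      using d f[OF X(1)[of n]] by (intro mult_right_mono) auto
    then have jump: "d * f (X n) - d * f (X (Suc n)) \<le> real S * f (X n) - real S * f (X (Suc n))"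
      by (simp only: right_diff_distrib)
    define D where "D = (\<Sum>m<n. (real (X (Suc m)) - real (X m)) * f (X m))"
    have "(\<Sum>m<Suc n. (real (X (Suc m)) - real (X m)) * f (X m)) = D + d * f (X n)"
      by (simp add: D_def d_def)
    then show ?case using Suc.IH up lo split jump
      unfolding D_def[symmetric] right_diff_distrib by linarith
  qed
  then show "sum f {X 0..<X n} \<le> (\<Sum>m<n. (real (X (Suc m)) - real (X m)) * f (X m))"
    and "(\<Sum>m<n. (real (X (Suc m)) - real (X m)) * f (X m))
           \<le> sum f {X 0..<X n} + real S * (f (X 0) - f (X n))"
    by auto
qed

lemma sum_le_sum_strict_mono:
  fixes f :: "nat \<Rightarrow> real" and X :: "nat \<Rightarrow> nat"
  assumes f: "\<And>i. 0 \<le> f i" and X: "\<And>m. X m < X (Suc m)"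
  shows "(\<Sum>m<n. f (X m)) \<le> sum f {X 0..<X n}"
proof (induction n)
  case 0
  then show ?case by simp
next
  case (Suc n)
  have le0: "X 0 \<le> X n" using X lift_Suc_mono_le[of X 0 n] by (simp add: less_imp_le)
  have "sum f {X 0..<X (Suc n)} = sum f {X 0..<X n} + sum f {X n..<X (Suc n)}"
    using le0 X[of n] by (simp add: sum.atLeastLessThan_concat)
  moreover have "sum f {X n} \<le> sum f {X n..<X (Suc n)}"
    using X[of n] f by (intro sum_mono2) auto
  ultimately show ?case using Suc.IH by simp
qed

text \<open>Splitting off the first term of the tail Q k of the squares turns
  \<open>Q k \<le> K * (q k)^2\<close> into \<open>Q (Suc k) \<le> (1 - 1 / K) * Q k\<close>. Hence
  Q, and with it q, decays geometrically from g on, with a constant that depends on K alone; the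
  final contradiction rests on this uniformity in g.\<close>

lemma suminf_geometric_decay:
  fixes q :: "nat \<Rightarrow> real" and K :: real
  assumes q: "\<And>k. 0 < q k" and K: "1 < K" and s2: "summable (\<lambda>j. (q j)\<^sup>2)"
    and tail: "\<And>k. g \<le> k \<Longrightarrow> (\<Sum>j. (q (j + k))\<^sup>2) \<le> K * (q k)\<^sup>2"
  shows "(\<Sum>j. q (j + g)) \<le> sqrt K / (1 - sqrt (1 - 1 / K)) * q g"
proof -
  define Q where "Q k = (\<Sum>j. (q (j + k))\<^sup>2)" for k
  have sk: "summable (\<lambda>j. (q (j + k))\<^sup>2)" for k
    using s2 using summable_iff_shift[of "\<lambda>j. (q j)\<^sup>2" k] by simp
  have Q_Suc: "Q k = (q k)\<^sup>2 + Q (Suc k)" for k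
    using suminf_split_head[OF sk[of k]] by (simp add: Q_def)
  have Q_nonneg: "0 \<le> Q k" for k
    unfolding Q_def using sk by (intro suminf_nonneg) auto
  define \<rho> where "\<rho> = 1 - 1 / K"
  have \<rho>: "0 < \<rho>" "\<rho> < 1" using K by (auto simp: \<rho>_def)
  have step: "Q (Suc k) \<le> \<rho> * Q k" if "g \<le> k" for k
  proof -
    have "Q k / K \<le> (q k)\<^sup>2"
      using tail[OF that] K by (simp add: Q_def field_simps)
    moreover have "\<rho> * Q k = Q k - Q k / K" by (simp add: \<rho>_def left_diff_distrib)
    ultimately show ?thesis using Q_Suc[of k] by linarith
  qed
  have Qpow: "Q (j + g) \<le> \<rho> ^ j * Q g" for j
  proof (induction j)
    case (Suc j)
    have "Q (Suc j + g) \<le> \<rho> * Q (j + g)" using step[of "j + g"] by simp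
    also have "\<dots> \<le> \<rho> * (\<rho> ^ j * Q g)" using Suc \<rho> by (intro mult_left_mono) auto
    finally show ?case by (simp add: mult.assoc)
  qed simp
  have qle: "q (j + g) \<le> sqrt K * q g * sqrt \<rho> ^ j" for j
  proof (rule power2_le_imp_le)
    have "(q (j + g))\<^sup>2 \<le> Q (j + g)" using Q_Suc[of "j + g"] Q_nonneg[of "Suc (j + g)"] by simp
    also have "\<dots> \<le> \<rho> ^ j * (K * (q g)\<^sup>2)"
      by (rule order_trans[OF Qpow]) (use tail[of g] \<rho> in \<open>auto simp: Q_def intro!: mult_left_mono\<close>)
    also have "\<dots> = (sqrt K * q g * sqrt \<rho> ^ j)\<^sup>2"
    proof -
      have "(sqrt \<rho> ^ j)\<^sup>2 = (sqrt \<rho>)\<^sup>2 ^ j" by (simp only: power_mult[symmetric] mult.commute)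
      then show ?thesis using K \<rho> by (simp add: power_mult_distrib)
    qed
    finally show "(q (j + g))\<^sup>2 \<le> (sqrt K * q g * sqrt \<rho> ^ j)\<^sup>2" .
    show "0 \<le> sqrt K * q g * sqrt \<rho> ^ j" using K \<rho> q[of g] by simp
  qed
  have geo: "(\<lambda>j. sqrt K * q g * sqrt \<rho> ^ j) sums (sqrt K * q g * (1 / (1 - sqrt \<rho>)))"
    using \<rho> by (intro sums_mult geometric_sums) auto
  have "summable (\<lambda>j. q (j + g))"
    by (rule summable_comparison_test[OF _ sums_summable[OF geo]])
       (use qle q in \<open>auto simp: less_imp_le\<close>)
  then have "(\<Sum>j. q (j + g)) \<le> sqrt K * q g * (1 / (1 - sqrt \<rho>))"
    using suminf_le[OF qle _ sums_summable[OF geo]] sums_unique[OF geo] by simp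
  then show ?thesis by (simp add: \<rho>_def mult.commute)
qed

text \<open>A binomial batch is s independent balls: splitting off one of them reduces the claim to
  the one-ball inequality at shifted arguments, hence the induction over arbitrary m and u. The
  jumps \<alpha> and -\<beta> stay fixed because all balls of a batch see the same counts.\<close>

lemma binomial_supermartingale:
  fixes \<phi> :: "real \<Rightarrow> real \<Rightarrow> real"
  assumes p: "0 \<le> p" "p \<le> 1"
    and ball: "\<And>m u. 0 \<le> u \<Longrightarrow>
      p * \<phi> (m + \<alpha>) (u + \<alpha>\<^sup>2) + (1 - p) * \<phi> (m - \<beta>) (u + \<beta>\<^sup>2) \<le> \<phi> m u"
    and u: "0 \<le> u"
  shows "(\<Sum>k\<le>s. pmf (binomial_pmf s p) k *
      \<phi> (m + real k * \<alpha> - (real s - real k) * \<beta>) (u + real k * \<alpha>\<^sup>2 + (real s - real k) * \<beta>\<^sup>2)) \<le> \<phi> m u"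
  using u
proof (induction s arbitrary: m u)
  case 0
  then show ?case using p by simp
next
  case (Suc s)
  let ?P = "\<lambda>s k. pmf (binomial_pmf s p) k"
  let ?g = "\<lambda>k. \<phi> (m + real k * \<alpha> - (real (Suc s) - real k) * \<beta>) (u + real k * \<alpha>\<^sup>2 + (real (Suc s) - real k) * \<beta>\<^sup>2)"
  have pm: "?P s' k = real (s' choose k) * p ^ k * (1 - p) ^ (s' - k)" for s' k
    using p by simp
  have "(\<Sum>k\<le>Suc s. ?P (Suc s) k * ?g k)
      = ?P (Suc s) 0 * ?g 0 + (\<Sum>k\<le>s. ?P (Suc s) (Suc k) * ?g (Suc k))"
    by (rule sum.atMost_Suc_shift)
  also have "\<dots> = ?P (Suc s) 0 * ?g 0 + (\<Sum>k\<le>s. (p * ?P s k + (1 - p) * ?P s (Suc k)) * ?g (Suc k))"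
  proof -
    \<comment> \<open>Pascal's rule for k < s. At k = s the subtraction \<open>s - Suc k\<close>
      truncates, but there the second summand vanishes because \<open>s choose Suc s\<close> is
      0.\<close>
    have "?P (Suc s) (Suc k) = p * ?P s k + (1 - p) * ?P s (Suc k)" if "k \<le> s" for k
    proof (cases "k = s")
      case False
      then have "s - k = Suc (s - Suc k)" using that by simp
      then show ?thesis unfolding pm by (simp add: algebra_simps)
    qed (simp add: pm)
    then show ?thesis by simp
  qed
  also have "\<dots> = (\<Sum>k\<le>s. p * ?P s k * ?g (Suc k)) +
      ((1 - p) * ?P s 0 * ?g 0 + (\<Sum>k\<le>s. (1 - p) * ?P s (Suc k) * ?g (Suc k)))"
  proof -
    have "?P (Suc s) 0 = (1 - p) * ?P s 0" by (simp add: pm)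
    then show ?thesis by (simp only: distrib_right sum.distrib add_ac)
  qed
  also have "(1 - p) * ?P s 0 * ?g 0 + (\<Sum>k\<le>s. (1 - p) * ?P s (Suc k) * ?g (Suc k)) =
      (\<Sum>k\<le>Suc s. (1 - p) * ?P s k * ?g k)"
    by (rule sum.atMost_Suc_shift[symmetric])
  also have "\<dots> = (\<Sum>k\<le>s. (1 - p) * ?P s k * ?g k)"
    using p by (simp add: pm)
  also have "(\<Sum>k\<le>s. p * ?P s k * ?g (Suc k)) =
      p * (\<Sum>k\<le>s. ?P s k * \<phi> ((m + \<alpha>) + real k * \<alpha> - (real s - real k) * \<beta>) ((u + \<alpha>\<^sup>2) + real k * \<alpha>\<^sup>2 + (real s - real k) * \<beta>\<^sup>2))"
    unfolding sum_distrib_left by (intro sum.cong refl) (simp add: algebra_simps)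
  also have "(\<Sum>k\<le>s. (1 - p) * ?P s k * ?g k) =
      (1 - p) * (\<Sum>k\<le>s. ?P s k * \<phi> ((m - \<beta>) + real k * \<alpha> - (real s - real k) * \<beta>) ((u + \<beta>\<^sup>2) + real k * \<alpha>\<^sup>2 + (real s - real k) * \<beta>\<^sup>2))"
    unfolding sum_distrib_left by (intro sum.cong refl) (simp add: algebra_simps)
  also have "p * (\<Sum>k\<le>s. ?P s k * \<phi> ((m + \<alpha>) + real k * \<alpha> - (real s - real k) * \<beta>) ((u + \<alpha>\<^sup>2) + real k * \<alpha>\<^sup>2 + (real s - real k) * \<beta>\<^sup>2)) + \<dots>
      \<le> p * \<phi> (m + \<alpha>) (u + \<alpha>\<^sup>2) + (1 - p) * \<phi> (m - \<beta>) (u + \<beta>\<^sup>2)"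
    using Suc p by (intro add_mono mult_left_mono) auto
  also have "\<dots> \<le> \<phi> m u" by (rule ball[OF Suc.prems])
  finally show ?case .
qed

section \<open>Histories of the urn\<close>

text \<open>These hypotheses survive exchanging the colours and conditioning on a history, with the
  same \<open>w\<close> and S, so that bounds proved here hold uniformly over all restarts. They
  constrain \<sigma> only from index 1 on, which suits the shifted sequences
  \<open>\<lambda>m. \<sigma> (n + m)\<close>.\<close>

locale bounded_gpu = gpu_process M w \<sigma> r\<^sub>0 b\<^sub>0 R B
  for M :: "'a measure" and w :: "nat \<Rightarrow> real" and \<sigma> :: "nat \<Rightarrow> nat" and r\<^sub>0 b\<^sub>0 :: nat
    and R B :: "nat \<Rightarrow> 'a \<Rightarrow> nat" +
  fixes S :: nat
  assumes w_pos: "\<And>k. 0 < w k" and w_mono: "mono w"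
    and \<sigma>_pos: "\<And>n. 0 < \<sigma> (Suc n)" and \<sigma>_le: "\<And>n. \<sigma> (Suc n) \<le> S"
begin

declare R_measurable[measurable] B_measurable[measurable]

definition red_prob :: "nat \<Rightarrow> nat \<Rightarrow> real" where
  "red_prob r b = w r / (w r + w b)"

lemma red_prob_bounds: "0 \<le> red_prob r b" "red_prob r b \<le> 1"
  using w_pos[of r] w_pos[of b] by (auto simp: red_prob_def)

lemma S_pos: "0 < S"
  using \<sigma>_pos[of 0] \<sigma>_le[of 0] by simp

text \<open>As a list, a history lives in a countable type and records its time in its
  length.\<close>

definition hist :: "nat \<Rightarrow> 'a \<Rightarrow> (nat \<times> nat) list" where
  "hist n \<omega> = map (\<lambda>i. (R i \<omega>, B i \<omega>)) [0..<Suc n]"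

lemma length_hist [simp]: "length (hist n \<omega>) = Suc n"
  by (simp add: hist_def)

lemma nth_hist [simp]: "i \<le> n \<Longrightarrow> hist n \<omega> ! i = (R i \<omega>, B i \<omega>)"
  by (simp add: hist_def less_Suc_eq_le del: upt_Suc)

lemma hist_eq_iff:
  "hist n \<omega> = h \<longleftrightarrow> length h = Suc n \<and> (\<forall>i\<le>n. R i \<omega> = fst (h ! i) \<and> B i \<omega> = snd (h ! i))"
  by (auto simp: list_eq_iff_nth_eq less_Suc_eq_le prod_eq_iff)

lemma hist_eqD:
  assumes "hist n \<omega> = hist n \<omega>'" "i \<le> n"
  shows "R i \<omega> = R i \<omega>'" "B i \<omega> = B i \<omega>'"
  using assms by (auto simp: hist_eq_iff)

lemma pred_hist [measurable]: "Measurable.pred M (\<lambda>\<omega>. hist n \<omega> = h)"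
  unfolding hist_eq_iff by measurable

lemma hist_measurable [measurable]: "hist n \<in> measurable M (count_space UNIV)"
proof -
  have "hist n -` {h} \<inter> space M \<in> sets M" for h
  proof -
    have "hist n -` {h} \<inter> space M = {\<omega> \<in> space M. hist n \<omega> = h}" by auto
    then show ?thesis using pred_hist by simp
  qed
  then show ?thesis by (simp add: measurable_count_space_eq2_countable)
qed

text \<open>Being determined by the past is expressed as invariance under equal histories.
  \<open>SOME\<close> picks a representative path, so such a function is a function of the list
  alone; measurability then becomes a pointwise check, as in \<open>sets_hist\<close>.\<close>

lemma hist_factor:
  assumes "\<And>\<omega> \<omega>'. hist n \<omega> = hist n \<omega>' \<Longrightarrow> f \<omega> = f \<omega>'"
  shows "f \<omega> = f (SOME \<omega>'. hist n \<omega>' = hist n \<omega>)"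
  by (rule assms) (metis (mono_tags, lifting) someI)

lemma sets_hist:
  assumes "\<And>\<omega> \<omega>'. hist n \<omega> = hist n \<omega>' \<Longrightarrow> P \<omega> = P \<omega>'"
  shows "{\<omega> \<in> space M. P \<omega>} \<in> sets M"
proof -
  define Q where "Q h = P (SOME \<omega>. hist n \<omega> = h)" for h
  have "P \<omega> = Q (hist n \<omega>)" for \<omega>
    unfolding Q_def by (rule hist_factor) (rule assms)
  then have "{\<omega> \<in> space M. P \<omega>} = hist n -` {h. Q h} \<inter> space M" by auto
  then show ?thesis using measurable_sets[OF hist_measurable, of "{h. Q h}" n] by simp
qed

lemma sets_hist_eq [measurable]: "{\<omega> \<in> space M. hist n \<omega> = h} \<in> sets M"
  by (rule sets_hist[where n = n]) simp

lemma sets_hist_step [measurable]: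
  "{\<omega> \<in> space M. hist n \<omega> = h \<and> R (Suc n) \<omega> = R n \<omega> + k} \<in> sets M"
  by (rule sets_hist[where n = "Suc n"]) (auto simp: hist_eq_iff)

text \<open>In product form the step law also covers lists of probability 0, where both sides
  vanish, so it can be summed over lists without case distinctions.\<close>

lemma hist_step:
  "\<P>(\<omega> in M. hist n \<omega> = h \<and> R (Suc n) \<omega> = R n \<omega> + k) =
     \<P>(\<omega> in M. hist n \<omega> = h) *
     pmf (binomial_pmf (\<sigma> (Suc n)) (red_prob (fst (h ! n)) (snd (h ! n)))) k"
proof (cases "\<P>(\<omega> in M. hist n \<omega> = h) = 0")
  case True
  have "\<P>(\<omega> in M. hist n \<omega> = h \<and> R (Suc n) \<omega> = R n \<omega> + k) \<le> \<P>(\<omega> in M. hist n \<omega> = h)"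
    by (intro finite_measure_mono) auto
  with True show ?thesis by (simp add: measure_le_0_iff)
next
  case False
  then have pos: "\<P>(\<omega> in M. hist n \<omega> = h) > 0"
    by (simp add: zero_less_measure_iff)
  have len: "length h = Suc n"
  proof (rule ccontr)
    assume "length h \<noteq> Suc n"
    then have "{\<omega> \<in> space M. hist n \<omega> = h} = {}" by (auto simp: hist_eq_iff)
    with False show False by (metis measure_empty)
  qed
  have eq: "(\<forall>i\<le>n. R i \<omega> = fst (h ! i) \<and> B i \<omega> = snd (h ! i)) \<longleftrightarrow> hist n \<omega> = h" for \<omega>
    by (simp add: hist_eq_iff len)
  show ?thesis
    using R_step[of n "\<lambda>i. fst (h ! i)" "\<lambda>i. snd (h ! i)" k] pos
    unfolding eq cond_prob_def red_prob_def by (simp add: field_simps conj_commute)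
qed

text \<open>Given a history, the increments up to \<open>\<sigma> (Suc n)\<close> already carry the
  whole binomial mass. Histories are countable, so the exceptional null sets can be united.\<close>

lemma AE_increment: "AE \<omega> in M. R n \<omega> \<le> R (Suc n) \<omega> \<and> R (Suc n) \<omega> \<le> R n \<omega> + \<sigma> (Suc n)"
proof -
  have "AE \<omega> in M. hist n \<omega> = h \<longrightarrow> (\<exists>k\<le>\<sigma> (Suc n). R (Suc n) \<omega> = R n \<omega> + k)" for h
  proof -
    let ?q = "red_prob (fst (h ! n)) (snd (h ! n))"
    let ?E = "\<lambda>k. {\<omega> \<in> space M. hist n \<omega> = h \<and> R (Suc n) \<omega> = R n \<omega> + k}"
    let ?H = "{\<omega> \<in> space M. hist n \<omega> = h}"
    have "prob (\<Union>k\<le>\<sigma> (Suc n). ?E k) = (\<Sum>k\<le>\<sigma> (Suc n). prob (?E k))"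
    proof (intro finite_measure_finite_Union)
      show "?E ` {..\<sigma> (Suc n)} \<subseteq> events"
        by auto
    qed (auto simp: disjoint_family_on_def)
    also have "\<dots> = prob ?H * (\<Sum>k\<le>\<sigma> (Suc n). pmf (binomial_pmf (\<sigma> (Suc n)) ?q) k)"
      by (simp add: hist_step sum_distrib_left)
    also have "(\<Sum>k\<le>\<sigma> (Suc n). pmf (binomial_pmf (\<sigma> (Suc n)) ?q) k) = 1"
      using red_prob_bounds by (intro sum_pmf_eq_1) (auto simp: set_pmf_binomial_eq)
    finally have "prob (?H - (\<Union>k\<le>\<sigma> (Suc n). ?E k)) = 0"
      by (subst finite_measure_Diff) auto
    then have "?H - (\<Union>k\<le>\<sigma> (Suc n). ?E k) \<in> null_sets M"
      by (intro null_setsI) (auto simp: emeasure_eq_measure)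
    then show ?thesis by (rule AE_I') auto
  qed
  then have "AE \<omega> in M. \<forall>h. hist n \<omega> = h \<longrightarrow> (\<exists>k\<le>\<sigma> (Suc n). R (Suc n) \<omega> = R n \<omega> + k)"
    by (subst AE_all_countable) auto
  then show ?thesis by eventually_elim auto
qed

text \<open>Gathers the almost sure properties of a path in one predicate, so that the later
  estimates along paths are deterministic.\<close>

definition regular :: "'a \<Rightarrow> bool" where
  "regular \<omega> \<longleftrightarrow> R 0 \<omega> = r\<^sub>0 \<and> B 0 \<omega> = b\<^sub>0 \<and> (\<forall>n. R n \<omega> \<le> R (Suc n) \<omega> \<and> B n \<omega> \<le> B (Suc n) \<omega> \<and>
     R (Suc n) \<omega> + B (Suc n) \<omega> = R n \<omega> + B n \<omega> + \<sigma> (Suc n))"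

lemma AE_regular: "AE \<omega> in M. regular \<omega>"
proof -
  have "AE \<omega> in M. \<forall>n. R n \<omega> \<le> R (Suc n) \<omega> \<and> R (Suc n) \<omega> \<le> R n \<omega> + \<sigma> (Suc n) \<and>
      R (Suc n) \<omega> + B (Suc n) \<omega> = R n \<omega> + B n \<omega> + \<sigma> (Suc n)"
    using AE_increment total_step by (subst AE_all_countable) auto
  then show ?thesis using R_initial B_initial
  proof eventually_elim
    case (elim \<omega>)
    have "B n \<omega> \<le> B (Suc n) \<omega>" for n using elim(1)[rule_format, of n] by linarith
    then show ?case using elim by (auto simp: regular_def)
  qed
qed

lemma
  assumes "regular \<omega>"
  shows regular_0: "R 0 \<omega> = r\<^sub>0" "B 0 \<omega> = b\<^sub>0"
    and regular_Suc: "\<And>n. R n \<omega> \<le> R (Suc n) \<omega>" "\<And>n. B n \<omega> \<le> B (Suc n) \<omega>"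
    and regular_total: "\<And>n. R (Suc n) \<omega> + B (Suc n) \<omega> = R n \<omega> + B n \<omega> + \<sigma> (Suc n)"
    and regular_mono: "\<And>m n. m \<le> n \<Longrightarrow> R m \<omega> \<le> R n \<omega>" "\<And>m n. m \<le> n \<Longrightarrow> B m \<omega> \<le> B n \<omega>"
    and regular_jump: "\<And>n. R (Suc n) \<omega> \<le> R n \<omega> + S" "\<And>n. B (Suc n) \<omega> \<le> B n \<omega> + S"
proof -
  show "R 0 \<omega> = r\<^sub>0" "B 0 \<omega> = b\<^sub>0" and s: "\<And>n. R n \<omega> \<le> R (Suc n) \<omega>" "\<And>n. B n \<omega> \<le> B (Suc n) \<omega>"
    and t: "\<And>n. R (Suc n) \<omega> + B (Suc n) \<omega> = R n \<omega> + B n \<omega> + \<sigma> (Suc n)"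
    using assms by (auto simp: regular_def)
  show "\<And>m n. m \<le> n \<Longrightarrow> R m \<omega> \<le> R n \<omega>" "\<And>m n. m \<le> n \<Longrightarrow> B m \<omega> \<le> B n \<omega>"
    using s lift_Suc_mono_le[of "\<lambda>n. R n \<omega>"] lift_Suc_mono_le[of "\<lambda>n. B n \<omega>"] by auto
  show "R (Suc n) \<omega> \<le> R n \<omega> + S" "B (Suc n) \<omega> \<le> B n \<omega> + S" for n
    using s[of n] t[of n] \<sigma>_le[of n] by linarith+
qed

section \<open>Finitely many histories: integrability and one-step expectations\<close>

definition hist_space :: "nat \<Rightarrow> (nat \<times> nat) list set" where
  "hist_space n = {h. set h \<subseteq> {..r\<^sub>0 + n * S} \<times> {..b\<^sub>0 + n * S} \<and> length h = Suc n}"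

lemma finite_hist_space: "finite (hist_space n)"
  unfolding hist_space_def by (rule finite_lists_length_eq) simp

lemma regular_hist_space:
  assumes "regular \<omega>"
  shows "hist n \<omega> \<in> hist_space n"
proof -
  have le: "R i \<omega> \<le> r\<^sub>0 + i * S \<and> B i \<omega> \<le> b\<^sub>0 + i * S" for i
  proof (induction i)
    case (Suc i)
    then show ?case using regular_jump[OF assms, of i] by simp
  qed (use regular_0[OF assms] in simp)
  have "R i \<omega> \<le> r\<^sub>0 + n * S \<and> B i \<omega> \<le> b\<^sub>0 + n * S" if "i \<le> n" for i
    using le[of n] regular_mono[OF assms that] by linarith
  then show ?thesis by (auto simp: hist_space_def hist_def simp del: upt_Suc)
qed

text \<open>Bounded batches leave regular paths only finitely many histories up to time n, so a
  function of the history is almost surely bounded.\<close>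

lemma integrable_hist:
  fixes f :: "'a \<Rightarrow> real"
  assumes f: "\<And>\<omega> \<omega>'. hist n \<omega> = hist n \<omega>' \<Longrightarrow> f \<omega> = f \<omega>'"
  shows "integrable M f"
proof -
  define g where "g h = f (SOME \<omega>. hist n \<omega> = h)" for h
  have fg: "f = (\<lambda>\<omega>. g (hist n \<omega>))"
    unfolding g_def by (rule ext) (rule hist_factor[OF f])
  have "AE \<omega> in M. norm (g (hist n \<omega>)) \<le> (\<Sum>h\<in>hist_space n. \<bar>g h\<bar>)"
    using AE_regular
  proof eventually_elim
    case (elim \<omega>)
    show ?case
      using member_le_sum[OF regular_hist_space[OF elim, of n], of "\<lambda>h. \<bar>g h\<bar>"] finite_hist_space by auto
  qed
  then show ?thesis unfolding fg by (rule integrable_const_bound) measurable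
qed

text \<open>The tower property at time n in elementary form: with finitely many histories, the
  conditional expectation given the past is a finite sum. Subtraction on naturals is harmless since
  R almost surely does not decrease.\<close>

lemma step_expectation:
  fixes f :: "'a \<Rightarrow> nat \<Rightarrow> real"
  assumes f: "\<And>\<omega> \<omega>'. hist n \<omega> = hist n \<omega>' \<Longrightarrow> f \<omega> = f \<omega>'"
  shows "expectation (\<lambda>\<omega>. f \<omega> (R (Suc n) \<omega> - R n \<omega>)) =
    expectation (\<lambda>\<omega>. \<Sum>k\<le>\<sigma> (Suc n). pmf (binomial_pmf (\<sigma> (Suc n)) (red_prob (R n \<omega>) (B n \<omega>))) k * f \<omega> k)"
proof -
  define g where "g h = f (SOME \<omega>. hist n \<omega> = h)" for h
  have fg: "f = (\<lambda>\<omega>. g (hist n \<omega>))"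
    unfolding g_def by (rule ext) (rule hist_factor[OF f])
  define s where "s = \<sigma> (Suc n)"
  define P where "P h k = pmf (binomial_pmf s (red_prob (fst (h ! n)) (snd (h ! n)))) k" for h k
  define E where "E h k = {\<omega> \<in> space M. hist n \<omega> = h \<and> R (Suc n) \<omega> = R n \<omega> + k}" for h k
  define H where "H h = {\<omega> \<in> space M. hist n \<omega> = h}" for h
  have [measurable]: "E h k \<in> sets M" "H h \<in> sets M" for h k
    unfolding E_def H_def by (rule sets_hist_step sets_hist_eq)+
  note fin = finite_hist_space[of n]
  have int: "integrable M (\<lambda>\<omega>. indicator A \<omega> * (c::real))"
    "expectation (\<lambda>\<omega>. indicator A \<omega> * (c::real)) = prob A * c" if "A \<in> sets M" for A c
    using that by (simp_all add: emeasure_eq_measure)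
  have E: "E h k \<in> sets M" and H: "H h \<in> sets M" for h k by simp_all
  \<comment> \<open>Almost surely the outcome lies in exactly one cell \<open>E h k\<close>, so the
    double sum reduces to one term.\<close>
  have "expectation (\<lambda>\<omega>. f \<omega> (R (Suc n) \<omega> - R n \<omega>)) =
      expectation (\<lambda>\<omega>. \<Sum>h\<in>hist_space n. \<Sum>k\<le>s. indicator (E h k) \<omega> * g h k)"
  proof (rule integral_cong_AE)
    show "(\<lambda>\<omega>. f \<omega> (R (Suc n) \<omega> - R n \<omega>)) \<in> borel_measurable M"
    proof (rule borel_measurable_integrable, rule integrable_hist[where n = "Suc n"])
      fix \<omega> \<omega>' assume eq: "hist (Suc n) \<omega> = hist (Suc n) \<omega>'"
      then have "hist n \<omega> = hist n \<omega>'" by (simp add: hist_def)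
      then show "f \<omega> (R (Suc n) \<omega> - R n \<omega>) = f \<omega>' (R (Suc n) \<omega>' - R n \<omega>')"
        using f[of \<omega> \<omega>'] hist_eqD(1)[OF eq, of n] hist_eqD(1)[OF eq, of "Suc n"] by simp
    qed
    show "AE \<omega> in M. f \<omega> (R (Suc n) \<omega> - R n \<omega>) = (\<Sum>h\<in>hist_space n. \<Sum>k\<le>s. indicator (E h k) \<omega> * g h k)"
      using AE_regular AE_increment[of n] AE_space
    proof eventually_elim
      case (elim \<omega>)
      have "(\<Sum>h\<in>hist_space n. \<Sum>k\<le>s. indicator (E h k) \<omega> * g h k) =
          (\<Sum>h\<in>hist_space n. if hist n \<omega> = h then (\<Sum>k\<le>s. indicator (E h k) \<omega> * g h k) else 0)"
        by (intro sum.cong refl) (auto simp: E_def)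
      also have "\<dots> = (\<Sum>k\<le>s. indicator (E (hist n \<omega>) k) \<omega> * g (hist n \<omega>) k)"
        using fin regular_hist_space[OF elim(1)] by simp
      also have "\<dots> = (\<Sum>k\<le>s. if R (Suc n) \<omega> - R n \<omega> = k then g (hist n \<omega>) k else 0)"
        using elim by (intro sum.cong refl) (auto simp: E_def)
      also have "\<dots> = g (hist n \<omega>) (R (Suc n) \<omega> - R n \<omega>)"
        using elim(2) by (auto simp: s_def)
      finally show ?case by (simp add: fg)
    qed
  qed (intro borel_measurable_sum borel_measurable_times borel_measurable_indicator borel_measurable_const, simp)
  also have "\<dots> = (\<Sum>h\<in>hist_space n. \<Sum>k\<le>s. prob (E h k) * g h k)"
    by (simp only: int[OF E] Bochner_Integration.integral_sum Bochner_Integration.integrable_sum)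
  also have "\<dots> = (\<Sum>h\<in>hist_space n. prob (H h) * (\<Sum>k\<le>s. P h k * g h k))"
    unfolding sum_distrib_left E_def H_def P_def s_def by (simp add: hist_step mult_ac)
  also have "\<dots> = expectation (\<lambda>\<omega>. \<Sum>h\<in>hist_space n. indicator (H h) \<omega> * (\<Sum>k\<le>s. P h k * g h k))"
    by (simp only: int[OF H] Bochner_Integration.integral_sum)
  also have "\<dots> = expectation (\<lambda>\<omega>. \<Sum>k\<le>s. P (hist n \<omega>) k * g (hist n \<omega>) k)"
  proof (rule integral_cong_AE)
    show "AE \<omega> in M. (\<Sum>h\<in>hist_space n. indicator (H h) \<omega> * (\<Sum>k\<le>s. P h k * g h k)) =
        (\<Sum>k\<le>s. P (hist n \<omega>) k * g (hist n \<omega>) k)"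
      using AE_regular AE_space
    proof eventually_elim
      case (elim \<omega>)
      have "(\<Sum>h\<in>hist_space n. indicator (H h) \<omega> * (\<Sum>k\<le>s. P h k * g h k)) =
        (\<Sum>h\<in>hist_space n. if hist n \<omega> = h then (\<Sum>k\<le>s. P h k * g h k) else 0)"
        using elim(2) by (intro sum.cong refl) (auto simp: H_def)
      then show ?case using fin regular_hist_space[OF elim(1)] by simp
    qed
    show "(\<lambda>\<omega>. \<Sum>k\<le>s. P (hist n \<omega>) k * g (hist n \<omega>) k) \<in> borel_measurable M"
      by (rule borel_measurable_integrable, rule integrable_hist[where n = n]) simp
  qed (intro borel_measurable_sum borel_measurable_times borel_measurable_indicator borel_measurable_const, simp)
  finally show ?thesis by (simp add: P_def fg s_def)
qed

end

section \<open>Symmetry, conditioning on a history, and runs without red balls\<close>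

context bounded_gpu
begin

text \<open>The blue increment is the batch size minus the red one, so the binomial law is
  reflected: k becomes s - k and p becomes 1 - p. This halves all later arguments about one
  colour.\<close>

lemma swap: "bounded_gpu M w \<sigma> b\<^sub>0 r\<^sub>0 B R S"
proof unfold_locales
  show "AE \<omega> in M. B (Suc n) \<omega> + R (Suc n) \<omega> = B n \<omega> + R n \<omega> + \<sigma> (Suc n)" for n
    using total_step[of n] by eventually_elim simp
  fix n k and r b :: "nat \<Rightarrow> nat"
  assume "\<P>(\<omega> in M. \<forall>i\<le>n. B i \<omega> = r i \<and> R i \<omega> = b i) > 0"
  then have pos: "\<P>(\<omega> in M. \<forall>i\<le>n. R i \<omega> = b i \<and> B i \<omega> = r i) > 0"
    by (simp add: conj_commute)
  define s where "s = \<sigma> (Suc n)"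
  define p where "p = w (r n) / (w (r n) + w (b n))"
  have p: "0 \<le> p" "p \<le> 1" and q: "w (b n) / (w (b n) + w (r n)) = 1 - p"
    using w_pos[of "r n"] w_pos[of "b n"] by (auto simp: p_def field_simps)
  have pred: "Measurable.pred M (\<lambda>\<omega>. X (Suc n) \<omega> = X n \<omega> + l)"
    if "X = R \<or> X = B" for X and l
    unfolding pred_def by (rule sets_hist[where n = "Suc n"]) (use that in \<open>auto simp: hist_eq_iff\<close>)
  have predH: "Measurable.pred M (\<lambda>\<omega>. \<forall>i\<le>n. R i \<omega> = b i \<and> B i \<omega> = r i)"
    unfolding pred_def by (rule sets_hist[where n = n]) (auto simp: hist_eq_iff)
  have "\<P>(\<omega> in M. B (Suc n) \<omega> = B n \<omega> + k \<bar> \<forall>i\<le>n. R i \<omega> = b i \<and> B i \<omega> = r i) = pmf (binomial_pmf s p) k"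
  proof (cases "k \<le> s")
    case True
    have "\<P>(\<omega> in M. B (Suc n) \<omega> = B n \<omega> + k \<bar> \<forall>i\<le>n. R i \<omega> = b i \<and> B i \<omega> = r i) =
        \<P>(\<omega> in M. R (Suc n) \<omega> = R n \<omega> + (s - k) \<bar> \<forall>i\<le>n. R i \<omega> = b i \<and> B i \<omega> = r i)"
    proof (rule cond_prob_eq_AE)
      show "AE \<omega> in M. (\<forall>i\<le>n. R i \<omega> = b i \<and> B i \<omega> = r i) \<longrightarrow>
          (B (Suc n) \<omega> = B n \<omega> + k) = (R (Suc n) \<omega> = R n \<omega> + (s - k))"
        using total_step[of n] by eventually_elim (use True in \<open>auto simp: s_def\<close>)
    qed (use pred predH in \<open>auto simp: pred_def\<close>)
    also have "\<dots> = pmf (binomial_pmf s (1 - p)) (s - k)"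
      using R_step[OF pos, of "s - k"] by (simp add: q s_def)
    also have "\<dots> = pmf (binomial_pmf s p) k"
      using p True by (simp add: binomial_symmetric[symmetric])
    finally show ?thesis .
  next
    case False
    \<comment> \<open>For k > s the subtraction \<open>s - k\<close> truncates; such an increment
      would force R to decrease.\<close>
    have "\<P>(\<omega> in M. B (Suc n) \<omega> = B n \<omega> + k \<and> (\<forall>i\<le>n. R i \<omega> = b i \<and> B i \<omega> = r i)) = 0"
    proof -
      have "AE \<omega> in M. \<not> (B (Suc n) \<omega> = B n \<omega> + k \<and> (\<forall>i\<le>n. R i \<omega> = b i \<and> B i \<omega> = r i))"
        using total_step[of n] AE_increment[of n]
        by eventually_elim (use False in \<open>auto simp: s_def\<close>)
      then show ?thesis
        by (intro measure_eq_0_null_sets AE_iff_null_sets[THEN iffD2])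
           (use pred predH in \<open>auto simp: pred_def\<close>)
    qed
    then show ?thesis using False p by (simp add: cond_prob_def)
  qed
  then show "\<P>(\<omega> in M. B (Suc n) \<omega> = B n \<omega> + k \<bar> \<forall>i\<le>n. B i \<omega> = r i \<and> R i \<omega> = b i) =
      pmf (binomial_pmf (\<sigma> (Suc n)) (w (r n) / (w (r n) + w (b n)))) k"
    by (simp add: s_def p_def conj_commute)
qed (use R_initial B_initial w_pos w_mono \<sigma>_pos \<sigma>_le in auto)

text \<open>The Markov property. Conditioning on h and then on a history of the later process
  amounts to conditioning on one longer history, to which the original step law applies; that law
  only looks at the last counts.\<close>

lemma shift:
  assumes pos: "\<P>(\<omega> in M. hist n \<omega> = h) > 0"
  shows "bounded_gpu (uniform_measure M {\<omega> \<in> space M. hist n \<omega> = h}) w (\<lambda>m. \<sigma> (n + m))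
           (fst (h ! n)) (snd (h ! n)) (\<lambda>m. R (n + m)) (\<lambda>m. B (n + m)) S"
proof -
  define H where "H = {\<omega> \<in> space M. hist n \<omega> = h}"
  have H: "H \<in> sets M" by (simp add: H_def)
  have posH: "0 < prob H" using pos by (simp add: H_def)
  interpret M': prob_space "uniform_measure M H"
    using posH by (intro prob_space_uniform_measure) (auto simp: emeasure_eq_measure)
  have len: "length h = Suc n"
  proof (rule ccontr)
    assume "length h \<noteq> Suc n"
    then have "H = {}" by (auto simp: hist_eq_iff H_def)
    with posH show False by simp
  qed
  have AE: "AE \<omega> in uniform_measure M H. P \<omega>"
    if "AE \<omega> in M. \<omega> \<in> H \<longrightarrow> P \<omega>" for P
    using that H by (intro AE_uniform_measureI) auto
  have meas: "X \<in> measurable (uniform_measure M H) (count_space UNIV)"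
    if "X \<in> measurable M (count_space UNIV)" for X :: "'a \<Rightarrow> nat"
    using that by (simp cong: measurable_cong_sets)
  have pr: "\<P>(\<omega> in uniform_measure M H. P \<omega>) = \<P>(\<omega> in M. P \<omega> \<and> hist n \<omega> = h) / prob H"
    if "{\<omega> \<in> space M. P \<omega>} \<in> sets M" for P
    unfolding H_def using that
    by (subst measure_uniform_measure_eq_cond_prob) (auto simp: cond_prob_def pred_def)
  have "bounded_gpu (uniform_measure M H) w (\<lambda>m. \<sigma> (n + m))
           (fst (h ! n)) (snd (h ! n)) (\<lambda>m. R (n + m)) (\<lambda>m. B (n + m)) S"
  proof unfold_locales
    show "R (n + m) \<in> measurable (uniform_measure M H) (count_space UNIV)"
      "B (n + m) \<in> measurable (uniform_measure M H) (count_space UNIV)" for m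
      by (intro meas R_measurable B_measurable)+
    show "AE \<omega> in uniform_measure M H. R (n + 0) \<omega> = fst (h ! n)"
      "AE \<omega> in uniform_measure M H. B (n + 0) \<omega> = snd (h ! n)"
      by (intro AE AE_I2; auto simp: H_def hist_eq_iff)+
    show "AE \<omega> in uniform_measure M H. R (n + Suc m) \<omega> + B (n + Suc m) \<omega>
        = R (n + m) \<omega> + B (n + m) \<omega> + \<sigma> (n + Suc m)" for m
      by (rule AE) (use total_step[of "n + m"] in \<open>auto\<close>)
    fix m k and r b :: "nat \<Rightarrow> nat"
    assume p': "\<P>(\<omega> in uniform_measure M H. \<forall>i\<le>m. R (n + i) \<omega> = r i \<and> B (n + i) \<omega> = b i) > 0"
    \<comment> \<open>\<open>rr\<close> and \<open>bb\<close> concatenate h with the later history;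
      index n belongs to both and is read from the latter.\<close>
    define rr where "rr i = (if i < n then fst (h ! i) else r (i - n))" for i
    define bb where "bb i = (if i < n then snd (h ! i) else b (i - n))" for i
    let ?Y = "\<lambda>\<omega>. \<forall>i\<le>m. R (n + i) \<omega> = r i \<and> B (n + i) \<omega> = b i"
    let ?Z = "\<lambda>\<omega>. \<forall>i\<le>n + m. R i \<omega> = rr i \<and> B i \<omega> = bb i"
    let ?X = "\<lambda>\<omega>. R (n + Suc m) \<omega> = R (n + m) \<omega> + k"
    have sY: "{\<omega> \<in> space M. ?Y \<omega>} \<in> sets M"
      by (rule sets_hist[where n = "n + m"]) (auto simp: hist_eq_iff)
    have sXY: "{\<omega> \<in> space M. ?X \<omega> \<and> ?Y \<omega>} \<in> sets M"
      by (rule sets_hist[where n = "Suc (n + m)"]) (auto simp: hist_eq_iff)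
    have posY: "\<P>(\<omega> in M. ?Y \<omega> \<and> hist n \<omega> = h) > 0"
      using p' posH unfolding pr[OF sY] by (simp add: zero_less_divide_iff)
    \<comment> \<open>Both histories prescribe the counts at time n; since their joint event is
      nonempty, they agree there.\<close>
    have "{\<omega> \<in> space M. ?Y \<omega> \<and> hist n \<omega> = h} \<noteq> {}"
    proof
      assume "{\<omega> \<in> space M. ?Y \<omega> \<and> hist n \<omega> = h} = {}"
      then show False using posY by (simp only: measure_empty less_irrefl)
    qed
    then obtain \<omega>\<^sub>1 where "?Y \<omega>\<^sub>1" "hist n \<omega>\<^sub>1 = h" by blast
    then have r0: "r 0 = fst (h ! n)" "b 0 = snd (h ! n)"
      by (auto simp: hist_eq_iff)
    have iff: "?Y \<omega> \<and> hist n \<omega> = h \<longleftrightarrow> ?Z \<omega>" for \<omega>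
    proof
      assume a: "?Y \<omega> \<and> hist n \<omega> = h"
      show "?Z \<omega>"
      proof (intro allI impI)
        fix i assume "i \<le> n + m"
        then show "R i \<omega> = rr i \<and> B i \<omega> = bb i"
          using a spec[of _ "i - n"] by (cases "i < n") (auto simp: rr_def bb_def hist_eq_iff dest: spec[of _ "i - n"])
      qed
    next
      assume a: "?Z \<omega>"
      have "?Y \<omega>"
      proof (intro allI impI)
        fix i assume "i \<le> m"
        then show "R (n + i) \<omega> = r i \<and> B (n + i) \<omega> = b i"
          using a[rule_format, of "n + i"] by (auto simp: rr_def bb_def)
      qed
      moreover have "hist n \<omega> = h"
        unfolding hist_eq_iff
      proof (intro conjI allI impI)
        fix i assume i: "i \<le> n"
        show "R i \<omega> = fst (h ! i)" "B i \<omega> = snd (h ! i)"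
          using a[rule_format, of i] i r0 by (auto simp: rr_def bb_def split: if_splits)
      qed (fact len)
      ultimately show "?Y \<omega> \<and> hist n \<omega> = h" ..
    qed
    have "\<P>(\<omega> in uniform_measure M H. ?X \<omega> \<bar> ?Y \<omega>) = \<P>(\<omega> in M. ?X \<omega> \<bar> ?Z \<omega>)"
      using posH unfolding cond_prob_def pr[OF sXY] pr[OF sY] by (simp add: conj_assoc iff)
    also have "\<dots> = pmf (binomial_pmf (\<sigma> (Suc (n + m))) (w (rr (n + m)) / (w (rr (n + m)) + w (bb (n + m))))) k"
      using R_step[of "n + m" rr bb k] posY by (simp add: iff)
    finally show "\<P>(\<omega> in uniform_measure M H. ?X \<omega> \<bar> ?Y \<omega>) =
        pmf (binomial_pmf (\<sigma> (n + Suc m)) (w (r m) / (w (r m) + w (b m)))) k"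
      by (simp add: rr_def bb_def)
  qed (use w_pos w_mono \<sigma>_pos \<sigma>_le in auto)
  then show ?thesis by (simp only: H_def)
qed

lemma prob_uniform_hist:
  assumes "{\<omega> \<in> space M. P \<omega>} \<in> sets M"
  shows "\<P>(\<omega> in uniform_measure M {\<omega> \<in> space M. hist n \<omega> = h}. P \<omega>) =
    \<P>(\<omega> in M. P \<omega> \<and> hist n \<omega> = h) / \<P>(\<omega> in M. hist n \<omega> = h)"
  using assms by (subst measure_uniform_measure_eq_cond_prob) (auto simp: cond_prob_def pred_def)

section \<open>The event that no red ball is ever added\<close>

definition blue_total :: "nat \<Rightarrow> nat" where
  "blue_total n = b\<^sub>0 + (\<Sum>i<n. \<sigma> (Suc i))"

lemma blue_total_Suc:
  "blue_total 0 = b\<^sub>0" "blue_total (Suc n) = blue_total n + \<sigma> (Suc n)"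
  by (auto simp: blue_total_def)

text \<open>Recording the blue counts as well makes the event a single history, so that
  \<open>hist_step\<close> with k = 0 yields the next factor.\<close>

lemma prob_never_red_until:
  "\<P>(\<omega> in M. \<forall>i\<le>n. R i \<omega> = r\<^sub>0 \<and> B i \<omega> = blue_total i) =
    (\<Prod>m<n. (1 - red_prob r\<^sub>0 (blue_total m)) ^ \<sigma> (Suc m))"
proof (induction n)
  case 0
  have "AE \<omega> in M. R 0 \<omega> = r\<^sub>0 \<and> B 0 \<omega> = b\<^sub>0" using R_initial B_initial by eventually_elim simp
  moreover have "{\<omega> \<in> space M. R 0 \<omega> = r\<^sub>0 \<and> B 0 \<omega> = b\<^sub>0} \<in> sets M"
    by (rule sets_hist[where n = 0]) (auto simp: hist_eq_iff)
  ultimately show ?case by (simp add: blue_total_Suc prob_Collect_eq_1)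
next
  case (Suc n)
  define h where "h = map (\<lambda>i. (r\<^sub>0, blue_total i)) [0..<Suc n]"
  have h: "hist n \<omega> = h \<longleftrightarrow> (\<forall>i\<le>n. R i \<omega> = r\<^sub>0 \<and> B i \<omega> = blue_total i)" for \<omega>
    by (auto simp: hist_eq_iff h_def less_Suc_eq_le simp del: upt_Suc)
  have hn: "h ! n = (r\<^sub>0, blue_total n)" by (simp add: h_def del: upt_Suc)
  have "\<P>(\<omega> in M. \<forall>i\<le>Suc n. R i \<omega> = r\<^sub>0 \<and> B i \<omega> = blue_total i) =
      \<P>(\<omega> in M. hist n \<omega> = h \<and> R (Suc n) \<omega> = R n \<omega> + 0)"
  proof (rule prob_eq_AE)
    show "AE \<omega> in M. (\<forall>i\<le>Suc n. R i \<omega> = r\<^sub>0 \<and> B i \<omega> = blue_total i) \<longleftrightarrow>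
        (hist n \<omega> = h \<and> R (Suc n) \<omega> = R n \<omega> + 0)"
      using total_step[of n] by eventually_elim (auto simp: h le_Suc_eq blue_total_Suc)
    show "{\<omega> \<in> space M. \<forall>i\<le>Suc n. R i \<omega> = r\<^sub>0 \<and> B i \<omega> = blue_total i} \<in> events"
      by (rule sets_hist[where n = "Suc n"]) (auto simp: hist_eq_iff)
  qed (rule sets_hist_step)
  also have "\<dots> = \<P>(\<omega> in M. hist n \<omega> = h) * (1 - red_prob r\<^sub>0 (blue_total n)) ^ \<sigma> (Suc n)"
    using red_prob_bounds by (subst hist_step) (simp add: hn)
  finally show ?case using Suc.IH by (simp add: h)
qed

lemma AE_never_red_iff:
  "AE \<omega> in M. (\<forall>i\<le>n. R i \<omega> = r\<^sub>0 \<and> B i \<omega> = blue_total i) \<longleftrightarrow> (\<forall>i\<le>n. R i \<omega> = r\<^sub>0)"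
  using AE_regular
proof eventually_elim
  case (elim \<omega>)
  have "B i \<omega> = blue_total i" if "\<forall>i\<le>n. R i \<omega> = r\<^sub>0" "i \<le> n" for i
    using that(2)
  proof (induction i)
    case (Suc i)
    then show ?case using that(1) regular_total[OF elim, of i] by (simp add: blue_total_Suc)
  qed (simp add: regular_0[OF elim] blue_total_Suc)
  then show ?case by blast
qed

lemma prob_never_red:
  "(\<lambda>n. \<Prod>m<n. (1 - red_prob r\<^sub>0 (blue_total m)) ^ \<sigma> (Suc m)) \<longlonglongrightarrow> \<P>(\<omega> in M. \<forall>n. R n \<omega> = r\<^sub>0)"
proof -
  let ?E = "\<lambda>n. {\<omega> \<in> space M. \<forall>i\<le>n. R i \<omega> = r\<^sub>0}"
  have sE: "?E n \<in> sets M" for n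
    by (rule sets_hist[where n = n]) (auto simp: hist_eq_iff)
  have "prob (?E n) = (\<Prod>m<n. (1 - red_prob r\<^sub>0 (blue_total m)) ^ \<sigma> (Suc m))" for n
    unfolding prob_never_red_until[symmetric]
  proof (rule prob_eq_AE)
    show "AE \<omega> in M. (\<forall>i\<le>n. R i \<omega> = r\<^sub>0) \<longleftrightarrow> (\<forall>i\<le>n. R i \<omega> = r\<^sub>0 \<and> B i \<omega> = blue_total i)"
      using AE_never_red_iff[of n] by eventually_elim blast
    show "{\<omega> \<in> space M. \<forall>i\<le>n. R i \<omega> = r\<^sub>0 \<and> B i \<omega> = blue_total i} \<in> events"
      by (rule sets_hist[where n = n]) (auto simp: hist_eq_iff)
  qed (rule sE)
  moreover have "(\<lambda>n. prob (?E n)) \<longlonglongrightarrow> prob (\<Inter>n. ?E n)"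
    using sE by (intro finite_Lim_measure_decseq) (auto simp: decseq_def)
  moreover have "(\<Inter>n. ?E n) = {\<omega> \<in> space M. \<forall>n. R n \<omega> = r\<^sub>0}" by auto
  ultimately show ?thesis by simp
qed

lemma blue_total_strict: "blue_total n < blue_total (Suc n)"
  using \<sigma>_pos[of n] by (simp add: blue_total_Suc)

lemma blue_total_ge: "b\<^sub>0 + n \<le> blue_total n"
proof (induction n)
  case (Suc n)
  then show ?case using blue_total_strict[of n] by simp
qed (simp add: blue_total_Suc)

lemma inverse_w_antimono: "i \<le> j \<Longrightarrow> 1 / w j \<le> 1 / w i"
  using w_mono w_pos by (simp add: frac_le monoD)

lemma blue_prob_eq: "1 - red_prob r b = 1 / (1 + w r * (1 / w b))"
  using w_pos[of r] w_pos[of b] by (simp add: red_prob_def field_simps)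

text \<open>If the infinite product had a positive value, it would bound the sum of
  \<open>1 / w\<close> along the blue counts. As these skip fewer than S integers at a time and
  \<open>1 / w\<close> is non-increasing, the whole series would converge.\<close>

lemma prob_never_red_eq_0:
  assumes "\<not> summable (\<lambda>k. 1 / w k)"
  shows "\<P>(\<omega> in M. \<forall>n. R n \<omega> = r\<^sub>0) = 0"
proof (rule ccontr)
  define \<pi> where "\<pi> = \<P>(\<omega> in M. \<forall>n. R n \<omega> = r\<^sub>0)"
  assume "\<P>(\<omega> in M. \<forall>n. R n \<omega> = r\<^sub>0) \<noteq> 0"
  then have \<pi>: "0 < \<pi>" by (simp add: \<pi>_def zero_less_measure_iff)
  define s where "s n = (\<Sum>m<n. 1 / w (blue_total m))" for n
  have s_nonneg: "0 \<le> s n" for n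
    unfolding s_def using w_pos by (intro sum_nonneg) (auto simp: less_imp_le)
  let ?P = "\<lambda>n. \<Prod>m<n. (1 - red_prob r\<^sub>0 (blue_total m)) ^ \<sigma> (Suc m)"
  have P_nonneg: "0 \<le> ?P n" for n
    using red_prob_bounds by (intro prod_nonneg) auto
  \<comment> \<open>Expanding a product of factors 1 + a with a > 0 gives at least 1 plus the sum of
    the a. Only one of the factors \<open>1 / (1 + a)\<close> of each batch is kept.\<close>
  have P_le: "?P n * (1 + w r\<^sub>0 * s n) \<le> 1" for n
  proof (induction n)
    case (Suc n)
    define a where "a = w r\<^sub>0 * (1 / w (blue_total n))"
    have a: "0 < a" using w_pos by (simp add: a_def)
    have c: "0 \<le> w r\<^sub>0 * s n" using w_pos[of r\<^sub>0] s_nonneg by simp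
    have "(1 - red_prob r\<^sub>0 (blue_total n)) ^ \<sigma> (Suc n) \<le> (1 - red_prob r\<^sub>0 (blue_total n)) ^ 1"
      using red_prob_bounds \<sigma>_pos[of n] by (intro power_decreasing) auto
    then have q: "(1 - red_prob r\<^sub>0 (blue_total n)) ^ \<sigma> (Suc n) \<le> 1 / (1 + a)"
      by (simp add: blue_prob_eq a_def)
    have "?P (Suc n) * (1 + w r\<^sub>0 * s (Suc n)) =
        ?P n * ((1 - red_prob r\<^sub>0 (blue_total n)) ^ \<sigma> (Suc n) * (1 + w r\<^sub>0 * s n + a))"
      by (simp add: s_def a_def algebra_simps)
    also have "\<dots> \<le> ?P n * (1 / (1 + a) * (1 + w r\<^sub>0 * s n + a))"
      using q P_nonneg[of n] c a by (intro mult_left_mono mult_right_mono) auto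
    also have "\<dots> \<le> ?P n * (1 + w r\<^sub>0 * s n)"
    proof (intro mult_left_mono P_nonneg)
      show "1 / (1 + a) * (1 + w r\<^sub>0 * s n + a) \<le> 1 + w r\<^sub>0 * s n"
        using a mult_nonneg_nonneg[OF less_imp_le[OF a] c] by (simp add: field_simps)
    qed
    finally show ?case using Suc by simp
  qed (simp add: s_def)
  have "\<pi> \<le> ?P n" for n
  proof (rule decseq_ge)
    show "?P \<longlonglongrightarrow> \<pi>" using prob_never_red by (simp add: \<pi>_def)
    show "decseq ?P"
    proof (rule decseq_SucI)
      fix n
      have "?P (Suc n) \<le> ?P n * 1"
        unfolding prod.lessThan_Suc using red_prob_bounds P_nonneg[of n]
        by (intro mult_left_mono power_le_one) auto
      then show "?P (Suc n) \<le> ?P n" by simp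
    qed
  qed
  then have "\<pi> * (1 + w r\<^sub>0 * s n) \<le> 1" for n
    using s_nonneg[of n] w_pos[of r\<^sub>0] by (intro order_trans[OF mult_right_mono P_le[of n]]) auto
  then have s_le: "s n \<le> 1 / (\<pi> * w r\<^sub>0)" for n
  proof -
    have "\<pi> * (w r\<^sub>0 * s n) \<le> 1" using \<open>\<pi> * (1 + w r\<^sub>0 * s n) \<le> 1\<close> \<pi> by (simp add: distrib_left)
    then show ?thesis using \<pi> w_pos[of r\<^sub>0] by (simp add: field_simps)
  qed
  \<comment> \<open>A batch passes at most S integers, each with \<open>1 / w\<close> at most its
    value at the start of the batch.\<close>
  have "(\<Sum>k<n. 1 / w (k + b\<^sub>0)) \<le> real S * (1 / (\<pi> * w r\<^sub>0))" for n
  proof -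
    have "(\<Sum>k<n. 1 / w (k + b\<^sub>0)) = (\<Sum>k\<in>{b\<^sub>0..<b\<^sub>0 + n}. 1 / w k)"
      by (rule sum.reindex_bij_witness[of _ "\<lambda>k. k - b\<^sub>0" "\<lambda>k. k + b\<^sub>0"]) auto
    also have "\<dots> \<le> (\<Sum>k\<in>{blue_total 0..<blue_total n}. 1 / w k)"
      using blue_total_ge[of n] w_pos
      by (intro sum_mono2) (auto simp: blue_total_Suc less_imp_le)
    also have "\<dots> \<le> (\<Sum>m<n. (real (blue_total (Suc m)) - real (blue_total m)) * (1 / w (blue_total m)))"
      using \<sigma>_le by (intro sum_increments_bounds inverse_w_antimono) (auto simp: blue_total_Suc)
    also have "\<dots> \<le> (\<Sum>m<n. real S * (1 / w (blue_total m)))"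
      using \<sigma>_le w_pos by (intro sum_mono mult_right_mono) (auto simp: blue_total_Suc less_imp_le)
    also have "\<dots> = real S * s n" by (simp add: s_def sum_distrib_left)
    also have "\<dots> \<le> real S * (1 / (\<pi> * w r\<^sub>0))" using s_le by (intro mult_left_mono) auto
    finally show ?thesis .
  qed
  then have "summable (\<lambda>k. 1 / w (k + b\<^sub>0))"
    using w_pos by (intro summableI_nonneg_bounded) (auto simp: less_imp_le)
  then show False using assms summable_iff_shift[of "\<lambda>k. 1 / w k" b\<^sub>0] by simp
qed

text \<open>Uses \<open>1 / (1 + a) \<ge> exp (- a)\<close>, at most S factors per batch, and that
  the blue counts at different times are distinct integers. The explicit exponent is needed: under
  geometric decay of \<open>1 / w\<close> it stays bounded over all restarts.\<close>

lemma prob_never_red_ge: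
  assumes sm: "summable (\<lambda>k. 1 / w k)"
  shows "exp (- (real S * w r\<^sub>0 * (\<Sum>k. 1 / w (k + b\<^sub>0)))) \<le> \<P>(\<omega> in M. \<forall>n. R n \<omega> = r\<^sub>0)"
proof (rule LIMSEQ_le_const[OF prob_never_red], intro exI allI impI)
  fix n
  have smb: "summable (\<lambda>k. 1 / w (k + b\<^sub>0))" using summable_iff_shift[of "\<lambda>k. 1 / w k" b\<^sub>0] sm by simp
  have "(\<Sum>m<n. 1 / w (blue_total m)) \<le> (\<Sum>k\<in>{blue_total 0..<blue_total n}. 1 / w k)"
    using w_pos blue_total_strict by (intro sum_le_sum_strict_mono) (auto simp: less_imp_le)
  also have "\<dots> = (\<Sum>k<blue_total n - b\<^sub>0. 1 / w (k + b\<^sub>0))"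
    by (rule sum.reindex_bij_witness[of _ "\<lambda>k. k + b\<^sub>0" "\<lambda>k. k - b\<^sub>0"]) (auto simp: blue_total_Suc)
  also have "\<dots> \<le> (\<Sum>k. 1 / w (k + b\<^sub>0))"
    using w_pos by (intro sum_le_suminf[OF smb]) (auto simp: less_imp_le)
  finally have "real S * w r\<^sub>0 * (\<Sum>m<n. 1 / w (blue_total m)) \<le> real S * w r\<^sub>0 * (\<Sum>k. 1 / w (k + b\<^sub>0))"
    using w_pos[of r\<^sub>0] by (intro mult_left_mono) auto
  then have "exp (- (real S * w r\<^sub>0 * (\<Sum>k. 1 / w (k + b\<^sub>0)))) \<le>
      exp (\<Sum>m<n. - (real S * w r\<^sub>0 * (1 / w (blue_total m))))"
    by (simp add: sum_distrib_left sum_negf)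
  also have "\<dots> = (\<Prod>m<n. exp (- (real S * w r\<^sub>0 * (1 / w (blue_total m)))))"
    by (simp add: exp_sum)
  also have "\<dots> \<le> (\<Prod>m<n. (1 - red_prob r\<^sub>0 (blue_total m)) ^ \<sigma> (Suc m))"
  proof (intro prod_mono conjI)
    fix m
    define a where "a = w r\<^sub>0 * (1 / w (blue_total m))"
    have a: "0 < a" using w_pos by (simp add: a_def)
    have "exp (- (real S * a)) \<le> exp (real (\<sigma> (Suc m)) * (- a))"
      using a \<sigma>_le[of m] by simp
    also have "\<dots> = exp (- a) ^ \<sigma> (Suc m)" by (rule exp_of_nat_mult)
    also have "\<dots> \<le> (1 / (1 + a)) ^ \<sigma> (Suc m)"
      using a exp_ge_add_one_self[of a]
      by (intro power_mono) (auto simp: exp_minus inverse_eq_divide intro!: divide_left_mono mult_pos_pos)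
    finally show "exp (- (real S * w r\<^sub>0 * (1 / w (blue_total m)))) \<le> (1 - red_prob r\<^sub>0 (blue_total m)) ^ \<sigma> (Suc m)"
      by (simp add: blue_prob_eq a_def mult.assoc)
  qed auto
  finally show "exp (- (real S * w r\<^sub>0 * (\<Sum>k. 1 / w (k + b\<^sub>0)))) \<le>
      (\<Prod>m<n. (1 - red_prob r\<^sub>0 (blue_total m)) ^ \<sigma> (Suc m))" .
qed

end

section \<open>The martingale and its moments\<close>

text \<open>Phrased as eventual growth rather than unboundedness, so that bounds for events at a
  single time pass to it by \<open>prob_eventually_le\<close>.\<close>

definition both_infinite :: "(nat \<Rightarrow> 'a \<Rightarrow> nat) \<Rightarrow> (nat \<Rightarrow> 'a \<Rightarrow> nat) \<Rightarrow> 'a \<Rightarrow> bool" where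
  "both_infinite X Y \<omega> \<longleftrightarrow> (\<forall>J. \<exists>N. \<forall>n\<ge>N. J \<le> X n \<omega> \<and> J \<le> Y n \<omega>)"

lemma both_infinite_commute: "both_infinite X Y \<omega> \<longleftrightarrow> both_infinite Y X \<omega>"
  by (simp add: both_infinite_def conj_commute)

lemma both_infinite_shift:
  "both_infinite (\<lambda>m. X (n + m)) (\<lambda>m. Y (n + m)) \<omega> \<longleftrightarrow> both_infinite X Y \<omega>"
proof -
  have "(\<exists>N. \<forall>m\<ge>N. J \<le> X (n + m) \<omega> \<and> J \<le> Y (n + m) \<omega>) \<longleftrightarrow> (\<exists>N. \<forall>m\<ge>N. J \<le> X m \<omega> \<and> J \<le> Y m \<omega>)" for J
    using eventually_sequentially_seg[of "\<lambda>m. J \<le> X m \<omega> \<and> J \<le> Y m \<omega>" n]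
    by (simp add: eventually_sequentially add.commute)
  then show ?thesis by (simp add: both_infinite_def)
qed

context bounded_gpu
begin

lemma sets_both_infinite: "{\<omega> \<in> space M. both_infinite R B \<omega>} \<in> sets M"
proof -
  have "{\<omega> \<in> space M. J \<le> R n \<omega> \<and> J \<le> B n \<omega>} \<in> sets M" for J n
    by (rule sets_hist[where n = n]) (auto simp: hist_eq_iff)
  then show ?thesis unfolding both_infinite_def
    by (intro sets.sets_Collect_countable_All sets.sets_Collect_countable_Ex sets.sets_Collect_imp)
       (auto intro: sets.sets_Collect_imp)
qed

text \<open>Red has probability \<open>w R / (w R + w B)\<close> and adds \<open>1 / w R\<close>,
  blue has probability \<open>w B / (w R + w B)\<close> and subtracts \<open>1 / w B\<close>; both
  products equal \<open>1 / (w R + w B)\<close>, so each ball is centred.\<close>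

definition mart :: "nat \<Rightarrow> 'a \<Rightarrow> real" where
  "mart n \<omega> = (\<Sum>m<n. (real (R (Suc m) \<omega>) - real (R m \<omega>)) * (1 / w (R m \<omega>))
                    - (real (B (Suc m) \<omega>) - real (B m \<omega>)) * (1 / w (B m \<omega>)))"

text \<open>The quadratic variation ball by ball, not the sum of the squared increments of whole
  batches.\<close>

definition qvar :: "nat \<Rightarrow> 'a \<Rightarrow> real" where
  "qvar n \<omega> = (\<Sum>m<n. (real (R (Suc m) \<omega>) - real (R m \<omega>)) * (1 / w (R m \<omega>))\<^sup>2
                    + (real (B (Suc m) \<omega>) - real (B m \<omega>)) * (1 / w (B m \<omega>))\<^sup>2)"

lemma mart_hist:
  assumes "hist n \<omega> = hist n \<omega>'"
  shows "mart n \<omega> = mart n \<omega>'" "qvar n \<omega> = qvar n \<omega>'"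
proof -
  have "R i \<omega> = R i \<omega>' \<and> B i \<omega> = B i \<omega>'" if "i \<le> n" for i
    using hist_eqD[OF assms that] by simp
  then show "mart n \<omega> = mart n \<omega>'" "qvar n \<omega> = qvar n \<omega>'"
    unfolding mart_def qvar_def by (auto intro!: sum.cong)
qed

lemma integrable_mart: "integrable M (\<lambda>\<omega>. (f :: real \<Rightarrow> real \<Rightarrow> real) (mart n \<omega>) (qvar n \<omega>))"
  by (rule integrable_hist[where n = n]) (metis mart_hist)

lemma regular_qvar_nonneg: "regular \<omega> \<Longrightarrow> 0 \<le> qvar n \<omega>"
  unfolding qvar_def by (intro sum_nonneg add_nonneg_nonneg mult_nonneg_nonneg) (auto simp: regular_Suc)

lemma AE_qvar_nonneg: "AE \<omega> in M. 0 \<le> qvar n \<omega>"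
  using AE_regular by eventually_elim (rule regular_qvar_nonneg)

text \<open>Each ball moves \<open>mart\<close> by a centred amount \<open>\<xi>\<close> and \<open>qvar\<close> by \<open>\<xi>\<^sup>2\<close>, and the balls of one
  batch are independent, so it suffices to control \<open>\<phi>\<close> along a single ball.\<close>

lemma expectation_mart_step:
  fixes \<phi> c :: "real \<Rightarrow> real \<Rightarrow> real"
  assumes \<phi>: "\<And>m u \<xi>. 0 \<le> u \<Longrightarrow> \<phi> (m + \<xi>) (u + \<xi>\<^sup>2) \<le> \<phi> m u + \<xi> * c m u"
  shows "expectation (\<lambda>\<omega>. \<phi> (mart (Suc n) \<omega>) (qvar (Suc n) \<omega>)) \<le> expectation (\<lambda>\<omega>. \<phi> (mart n \<omega>) (qvar n \<omega>))"
proof -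
  define s where "s = \<sigma> (Suc n)"
  define f where "f \<omega> k = \<phi> (mart n \<omega> + real k * (1 / w (R n \<omega>)) - (real s - real k) * (1 / w (B n \<omega>)))
      (qvar n \<omega> + real k * (1 / w (R n \<omega>))\<^sup>2 + (real s - real k) * (1 / w (B n \<omega>))\<^sup>2)" for \<omega> k
  have f_hist: "f \<omega> = f \<omega>'" if "hist n \<omega> = hist n \<omega>'" for \<omega> \<omega>'
    using mart_hist[OF that] hist_eqD[OF that, of n] by (simp add: f_def fun_eq_iff)
  let ?P = "\<lambda>\<omega> k. pmf (binomial_pmf s (red_prob (R n \<omega>) (B n \<omega>))) k"
  have "expectation (\<lambda>\<omega>. \<phi> (mart (Suc n) \<omega>) (qvar (Suc n) \<omega>)) = expectation (\<lambda>\<omega>. f \<omega> (R (Suc n) \<omega> - R n \<omega>))"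
  proof (rule integral_cong_AE)
    show "(\<lambda>\<omega>. \<phi> (mart (Suc n) \<omega>) (qvar (Suc n) \<omega>)) \<in> borel_measurable M"
      by (rule borel_measurable_integrable[OF integrable_mart])
    show "(\<lambda>\<omega>. f \<omega> (R (Suc n) \<omega> - R n \<omega>)) \<in> borel_measurable M"
    proof (rule borel_measurable_integrable, rule integrable_hist[where n = "Suc n"])
      fix \<omega> \<omega>' assume eq: "hist (Suc n) \<omega> = hist (Suc n) \<omega>'"
      then have "hist n \<omega> = hist n \<omega>'" by (simp add: hist_def)
      then show "f \<omega> (R (Suc n) \<omega> - R n \<omega>) = f \<omega>' (R (Suc n) \<omega>' - R n \<omega>')"
        using f_hist[of \<omega> \<omega>'] hist_eqD(1)[OF eq, of n] hist_eqD(1)[OF eq, of "Suc n"] by simp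
    qed
    show "AE \<omega> in M. \<phi> (mart (Suc n) \<omega>) (qvar (Suc n) \<omega>) = f \<omega> (R (Suc n) \<omega> - R n \<omega>)"
      using AE_regular
    proof eventually_elim
      case (elim \<omega>)
      have k: "real (R (Suc n) \<omega> - R n \<omega>) = real (R (Suc n) \<omega>) - real (R n \<omega>)"
        using regular_Suc(1)[OF elim, of n] by simp
      have "real (R (Suc n) \<omega>) + real (B (Suc n) \<omega>) = real (R n \<omega>) + real (B n \<omega>) + real s"
        using regular_total[OF elim, of n] unfolding s_def by linarith
      then have sk: "real s - (real (R (Suc n) \<omega>) - real (R n \<omega>)) = real (B (Suc n) \<omega>) - real (B n \<omega>)"
        by linarith
      show ?case unfolding f_def k sk by (simp add: mart_def qvar_def add.assoc diff_add_eq add_diff_eq)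
    qed
  qed
  also have "\<dots> = expectation (\<lambda>\<omega>. \<Sum>k\<le>s. ?P \<omega> k * f \<omega> k)"
    unfolding s_def by (rule step_expectation) (rule f_hist)
  also have "\<dots> \<le> expectation (\<lambda>\<omega>. \<phi> (mart n \<omega>) (qvar n \<omega>))"
  proof (rule integral_mono_AE)
    show "integrable M (\<lambda>\<omega>. \<Sum>k\<le>s. ?P \<omega> k * f \<omega> k)"
    proof (rule integrable_hist[where n = n])
      fix \<omega> \<omega>' assume eq: "hist n \<omega> = hist n \<omega>'"
      show "(\<Sum>k\<le>s. ?P \<omega> k * f \<omega> k) = (\<Sum>k\<le>s. ?P \<omega>' k * f \<omega>' k)"
        using f_hist[OF eq] hist_eqD[OF eq, of n] by simp
    qed
    show "integrable M (\<lambda>\<omega>. \<phi> (mart n \<omega>) (qvar n \<omega>))" by (rule integrable_mart)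
    show "AE \<omega> in M. (\<Sum>k\<le>s. ?P \<omega> k * f \<omega> k) \<le> \<phi> (mart n \<omega>) (qvar n \<omega>)"
      using AE_qvar_nonneg[of n]
    proof eventually_elim
      case (elim \<omega>)
      define p where "p = red_prob (R n \<omega>) (B n \<omega>)"
      define \<alpha> where "\<alpha> = 1 / w (R n \<omega>)"
      define \<beta> where "\<beta> = 1 / w (B n \<omega>)"
      have p: "0 \<le> p" "p \<le> 1" by (auto simp: p_def red_prob_bounds)
      have centred: "p * \<alpha> - (1 - p) * \<beta> = 0"
        using w_pos[of "R n \<omega>"] w_pos[of "B n \<omega>"]
        by (simp add: p_def \<alpha>_def \<beta>_def red_prob_def field_simps)
      have "(\<Sum>k\<le>s. pmf (binomial_pmf s p) k *
          \<phi> (mart n \<omega> + real k * \<alpha> - (real s - real k) * \<beta>) (qvar n \<omega> + real k * \<alpha>\<^sup>2 + (real s - real k) * \<beta>\<^sup>2))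
          \<le> \<phi> (mart n \<omega>) (qvar n \<omega>)"
      proof (rule binomial_supermartingale[OF p _ elim])
        fix m u :: real assume u: "0 \<le> u"
        have "p * \<phi> (m + \<alpha>) (u + \<alpha>\<^sup>2) + (1 - p) * \<phi> (m + - \<beta>) (u + (- \<beta>)\<^sup>2)
            \<le> p * (\<phi> m u + \<alpha> * c m u) + (1 - p) * (\<phi> m u + - \<beta> * c m u)"
          using p by (intro add_mono mult_left_mono \<phi>[OF u]) auto
        also have "\<dots> = \<phi> m u + (p * \<alpha> - (1 - p) * \<beta>) * c m u" by (simp add: algebra_simps)
        finally show "p * \<phi> (m + \<alpha>) (u + \<alpha>\<^sup>2) + (1 - p) * \<phi> (m - \<beta>) (u + \<beta>\<^sup>2) \<le> \<phi> m u"
          by (simp add: centred)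
      qed
      then show ?case by (simp add: f_def p_def \<alpha>_def \<beta>_def)
    qed
  qed
  finally show ?thesis .
qed

lemma expectation_mart_le:
  fixes \<phi> c :: "real \<Rightarrow> real \<Rightarrow> real"
  assumes \<phi>: "\<And>m u \<xi>. 0 \<le> u \<Longrightarrow> \<phi> (m + \<xi>) (u + \<xi>\<^sup>2) \<le> \<phi> m u + \<xi> * c m u"
  shows "expectation (\<lambda>\<omega>. \<phi> (mart n \<omega>) (qvar n \<omega>)) \<le> \<phi> 0 0"
proof (induction n)
  case 0
  then show ?case by (simp add: mart_def qvar_def prob_space)
next
  case (Suc n)
  then show ?case using expectation_mart_step[OF \<phi>, of n] by simp
qed

lemma expectation_mart: "expectation (mart n) = 0"
  using expectation_mart_le[of "\<lambda>m u. m" "\<lambda>m u. 1" n] expectation_mart_le[of "\<lambda>m u. - m" "\<lambda>m u. - 1" n]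
  by simp

text \<open>Along one ball \<open>m^2 - u\<close> changes by exactly \<open>2 * m * \<xi>\<close>,
  so the supermartingale bound applies to it with both signs.\<close>

lemma expectation_mart_square: "expectation (\<lambda>\<omega>. (mart n \<omega>)\<^sup>2) = expectation (qvar n)"
proof -
  have "expectation (\<lambda>\<omega>. (mart n \<omega>)\<^sup>2 - qvar n \<omega>) \<le> 0"
    using expectation_mart_le[of "\<lambda>m u. m\<^sup>2 - u" "\<lambda>m u. 2 * m" n] by (simp add: power2_sum algebra_simps)
  moreover have "expectation (\<lambda>\<omega>. qvar n \<omega> - (mart n \<omega>)\<^sup>2) \<le> 0"
    using expectation_mart_le[of "\<lambda>m u. u - m\<^sup>2" "\<lambda>m u. - 2 * m" n] by (simp add: power2_sum algebra_simps)
  ultimately show ?thesis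
    using integrable_mart[of "\<lambda>m u. m\<^sup>2" n] integrable_mart[of "\<lambda>m u. u" n] by simp
qed

text \<open>A fourth-moment inequality of Burkholder type, obtained by exhibiting a supermartingale
  that is polynomial in \<open>mart\<close> and \<open>qvar\<close>.\<close>

lemma expectation_mart_fourth:
  "expectation (\<lambda>\<omega>. (mart n \<omega>) ^ 4) \<le>
     8 * expectation (\<lambda>\<omega>. (mart n \<omega>)\<^sup>2 * qvar n \<omega>) + 11 * expectation (\<lambda>\<omega>. (qvar n \<omega>)\<^sup>2)"
proof -
  have "expectation (\<lambda>\<omega>. (mart n \<omega>) ^ 4 - 8 * ((mart n \<omega>)\<^sup>2 * qvar n \<omega>) - 11 * (qvar n \<omega>)\<^sup>2) \<le>
      (0::real) ^ 4 - 8 * (0\<^sup>2 * 0) - 11 * 0\<^sup>2"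
  proof (rule expectation_mart_le[of "\<lambda>m u. m ^ 4 - 8 * (m\<^sup>2 * u) - 11 * u\<^sup>2" "\<lambda>m u. 4 * m ^ 3 - 16 * m * u"])
    fix m u \<xi> :: real assume u: "0 \<le> u"
    \<comment> \<open>The term \<open>6 * m^2 * \<xi>^2\<close> of the fourth power has to be
      beaten, so 8 leaves -2; the cross term \<open>-12 * m * \<xi>^3\<close> then requires at most
      -18 in front of \<open>\<xi>^4\<close> to complete the square, and 1 - 8 - 11 = -18.\<close>
    have "(m + \<xi>) ^ 4 - 8 * ((m + \<xi>)\<^sup>2 * (u + \<xi>\<^sup>2)) - 11 * (u + \<xi>\<^sup>2)\<^sup>2 =
        m ^ 4 - 8 * (m\<^sup>2 * u) - 11 * u\<^sup>2 + \<xi> * (4 * m ^ 3 - 16 * m * u)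
          - 2 * (\<xi> * (m + 3 * \<xi>))\<^sup>2 - 30 * (u * \<xi>\<^sup>2)"
      by algebra
    then show "(m + \<xi>) ^ 4 - 8 * ((m + \<xi>)\<^sup>2 * (u + \<xi>\<^sup>2)) - 11 * (u + \<xi>\<^sup>2)\<^sup>2 \<le>
        m ^ 4 - 8 * (m\<^sup>2 * u) - 11 * u\<^sup>2 + \<xi> * (4 * m ^ 3 - 16 * m * u)"
      using u zero_le_power2[of "\<xi> * (m + 3 * \<xi>)"] mult_nonneg_nonneg[OF u zero_le_power2[of \<xi>]] by linarith
  qed
  moreover have "expectation (\<lambda>\<omega>. (mart n \<omega>) ^ 4 - 8 * ((mart n \<omega>)\<^sup>2 * qvar n \<omega>) - 11 * (qvar n \<omega>)\<^sup>2) =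
      expectation (\<lambda>\<omega>. (mart n \<omega>) ^ 4) - 8 * expectation (\<lambda>\<omega>. (mart n \<omega>)\<^sup>2 * qvar n \<omega>) -
      11 * expectation (\<lambda>\<omega>. (qvar n \<omega>)\<^sup>2)"
    using integrable_mart[of "\<lambda>m u. m ^ 4" n] integrable_mart[of "\<lambda>m u. m\<^sup>2 * u" n]
      integrable_mart[of "\<lambda>m u. u\<^sup>2" n] by simp
  ultimately show ?thesis by simp
qed

end

section \<open>Both colours infinite: bounds away from 1\<close>

text \<open>Fatou's lemma for events: the sets on which P holds from time N on increase with N, and
  their union contains A.\<close>

lemma (in prob_space) prob_eventually_le:
  fixes P :: "nat \<Rightarrow> 'a \<Rightarrow> bool"
  assumes P: "\<And>n. {\<omega> \<in> space M. P n \<omega>} \<in> sets M" "\<And>n. \<P>(\<omega> in M. P n \<omega>) \<le> c"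
    and A: "A \<subseteq> {\<omega> \<in> space M. \<exists>N. \<forall>n\<ge>N. P n \<omega>}"
  shows "prob A \<le> c"
proof -
  let ?E = "\<lambda>N. {\<omega> \<in> space M. \<forall>n. N \<le> n \<longrightarrow> P n \<omega>}"
  have E: "?E N \<in> sets M" for N
  proof (rule sets.sets_Collect_countable_All)
    show "{\<omega> \<in> space M. N \<le> n \<longrightarrow> P n \<omega>} \<in> sets M" for n
      using P(1)[of n] by (cases "N \<le> n") simp_all
  qed
  have "incseq ?E" by (force simp: incseq_def)
  then have "(\<lambda>N. prob (?E N)) \<longlonglongrightarrow> prob (\<Union>N. ?E N)"
    using E by (intro finite_Lim_measure_incseq) blast+
  moreover have "prob (?E N) \<le> c" for N
    by (rule order_trans[OF finite_measure_mono P(2)[of N]]) (auto intro: P(1))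
  ultimately have "prob (\<Union>N. ?E N) \<le> c" by (blast intro: LIMSEQ_le_const2)
  moreover have "prob A \<le> prob (\<Union>N. ?E N)"
  proof (rule finite_measure_mono)
    show "A \<subseteq> (\<Union>N. ?E N)" using A by blast
    show "(\<Union>N. ?E N) \<in> sets M" using E by blast
  qed
  ultimately show ?thesis by simp
qed

lemma sum_from_approx:
  fixes f :: "nat \<Rightarrow> real"
  assumes f: "summable f" "\<And>k. 0 \<le> f k" and e: "0 < e"
  obtains J where "\<And>a. J \<le> a \<Longrightarrow> (\<Sum>k. f (k + r)) - e \<le> sum f {r..<a}"
    and "\<And>a. sum f {r..<a} \<le> (\<Sum>k. f (k + r))"
proof -
  have eq: "sum f {r..<a} = (\<Sum>k<a - r. f (k + r))" for a
    by (rule sum.reindex_bij_witness[of _ "\<lambda>k. k + r" "\<lambda>k. k - r"]) auto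
  have sm: "summable (\<lambda>k. f (k + r))" using summable_iff_shift[of f r] f(1) by simp
  have "eventually (\<lambda>n. (\<Sum>k. f (k + r)) - e < (\<Sum>k<n. f (k + r))) sequentially"
    using summable_LIMSEQ[OF sm] e by (intro order_tendstoD) auto
  then obtain N where N: "\<And>n. N \<le> n \<Longrightarrow> (\<Sum>k. f (k + r)) - e < (\<Sum>k<n. f (k + r))"
    by (auto simp: eventually_sequentially)
  show thesis
  proof
    show "(\<Sum>k. f (k + r)) - e \<le> sum f {r..<a}" if "N + r \<le> a" for a
    proof -
      have "N \<le> a - r" using that by linarith
      from N[OF this] show ?thesis unfolding eq by simp
    qed
    show "sum f {r..<a} \<le> (\<Sum>k. f (k + r))" for a
      unfolding eq by (rule sum_le_suminf[OF sm]) (auto simp: f)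
  qed
qed

context bounded_gpu
begin

definition square_tail :: "nat \<Rightarrow> real" where
  "square_tail k = (\<Sum>j. (1 / w (j + k))\<^sup>2)"

lemma summable_square:
  assumes sm: "summable (\<lambda>k. 1 / w k)"
  shows "summable (\<lambda>k. (1 / w k)\<^sup>2)"
proof (rule summable_comparison_test)
  show "\<exists>N. \<forall>n\<ge>N. norm ((1 / w n)\<^sup>2) \<le> 1 / w 0 * (1 / w n)"
    using inverse_w_antimono[of 0] w_pos
    by (auto simp: power2_eq_square less_imp_le abs_of_pos simp del: times_divide_eq_left times_divide_eq_right
        intro!: mult_right_mono)
qed (rule summable_mult[OF sm])

lemma square_tail_pos:
  assumes "summable (\<lambda>k. 1 / w k)"
  shows "0 < square_tail k"
  unfolding square_tail_def
proof (rule suminf_pos)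
  show "summable (\<lambda>j. (1 / w (j + k))\<^sup>2)"
    using summable_iff_shift[of "\<lambda>j. (1 / w j)\<^sup>2" k] summable_square[OF assms] by simp
  show "0 < (1 / w (j + k))\<^sup>2" for j using w_pos[of "j + k"] by simp
qed

text \<open>\<open>mart\<close> is a martingale whose variance is the expectation of \<open>qvar\<close>. When both colours become
  infinite, \<open>mart\<close> lands within \<open>2 S \<delta>\<close> of the constant \<open>x\<close> below while \<open>qvar\<close> exceeds \<open>V / 2\<close>. If
  this were almost certain, the variance \<open>\<ge> V / 2\<close> would have to come from an event of small
  probability, which the bound on the fourth moment excludes.\<close>

lemma prob_both_infinite_le_of_spread:
  assumes sm: "summable (\<lambda>k. 1 / w k)"
    and spread: "32 * (real S)\<^sup>2 * (1 / w (min r\<^sub>0 b\<^sub>0))\<^sup>2 \<le> square_tail r\<^sub>0 + square_tail b\<^sub>0"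
  shows "\<P>(\<omega> in M. both_infinite R B \<omega>) \<le> 1 - 1 / 60800"
proof -
  define \<delta> where "\<delta> = 1 / w (min r\<^sub>0 b\<^sub>0)"
  define V where "V = square_tail r\<^sub>0 + square_tail b\<^sub>0"
  define f where "f k = 1 / w k" for k
  define f2 where "f2 k = (1 / w k)\<^sup>2" for k
  define x where "x = (\<Sum>k. f (k + r\<^sub>0)) - (\<Sum>k. f (k + b\<^sub>0))"
  define W where "W = x\<^sup>2 + V"
  have \<delta>: "0 < \<delta>" using w_pos by (simp add: \<delta>_def)
  have S1: "1 \<le> real S" using S_pos by linarith
  have V: "0 < V" using square_tail_pos[OF sm] by (simp add: V_def add_pos_pos)
  have KV: "32 * (real S * \<delta>)\<^sup>2 \<le> V" using spread by (simp add: V_def \<delta>_def power_mult_distrib power_divide)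
  have S\<delta>: "0 < real S * \<delta>" using \<delta> S1 by simp
  have f_pos: "0 \<le> f k" "0 \<le> f2 k" for k using w_pos[of k] by (auto simp: f_def f2_def)
  have f_le: "f r\<^sub>0 \<le> \<delta>" "f b\<^sub>0 \<le> \<delta>"
    unfolding f_def \<delta>_def by (intro inverse_w_antimono; simp)+
  have anti: "f j \<le> f i" "f2 j \<le> f2 i" if "i \<le> j" for i j
    using inverse_w_antimono[OF that] w_pos[of j] unfolding f_def f2_def
    by (auto intro!: power_mono simp: less_imp_le)
  have f2_le: "f2 r\<^sub>0 \<le> \<delta>\<^sup>2" "f2 b\<^sub>0 \<le> \<delta>\<^sup>2"
    using f_le f_pos unfolding f2_def f_def by (auto intro!: power_mono)
  have smf: "summable f" "summable f2" using sm summable_square[OF sm] by (simp_all add: f_def[abs_def] f2_def[abs_def])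
  have V_eq: "V = (\<Sum>k. f2 (k + r\<^sub>0)) + (\<Sum>k. f2 (k + b\<^sub>0))" by (simp add: V_def square_tail_def f2_def)
  \<comment> \<open>The truncation tolerance matches the batch error
    \<open>real S * \<delta>\<close>: once both counts exceed J, each colour's sum lies within e of
    its series and \<open>mart\<close> within 2 e of x.\<close>
  define e where "e = real S * \<delta>"
  have e: "0 < e" using S\<delta> by (simp add: e_def)
  obtain J1 where J1: "\<And>a. J1 \<le> a \<Longrightarrow> (\<Sum>k. f (k + r\<^sub>0)) - e \<le> sum f {r\<^sub>0..<a}"
    "\<And>a. sum f {r\<^sub>0..<a} \<le> (\<Sum>k. f (k + r\<^sub>0))" using sum_from_approx[OF smf(1) f_pos(1) e] by blast
  obtain J2 where J2: "\<And>a. J2 \<le> a \<Longrightarrow> (\<Sum>k. f (k + b\<^sub>0)) - e \<le> sum f {b\<^sub>0..<a}"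
    "\<And>a. sum f {b\<^sub>0..<a} \<le> (\<Sum>k. f (k + b\<^sub>0))" using sum_from_approx[OF smf(1) f_pos(1) e] by blast
  have V4: "0 < V / 4" using V by simp
  obtain J3 where J3: "\<And>a. J3 \<le> a \<Longrightarrow> (\<Sum>k. f2 (k + r\<^sub>0)) - V / 4 \<le> sum f2 {r\<^sub>0..<a}"
    "\<And>a. sum f2 {r\<^sub>0..<a} \<le> (\<Sum>k. f2 (k + r\<^sub>0))" using sum_from_approx[OF smf(2) f_pos(2) V4] by blast
  obtain J4 where J4: "\<And>a. J4 \<le> a \<Longrightarrow> (\<Sum>k. f2 (k + b\<^sub>0)) - V / 4 \<le> sum f2 {b\<^sub>0..<a}"
    "\<And>a. sum f2 {b\<^sub>0..<a} \<le> (\<Sum>k. f2 (k + b\<^sub>0))" using sum_from_approx[OF smf(2) f_pos(2) V4] by blast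
  define J where "J = Max {J1, J2, J3, J4}"
  have J: "J1 \<le> J" "J2 \<le> J" "J3 \<le> J" "J4 \<le> J" by (auto simp: J_def)
  define G where "G n \<omega> \<longleftrightarrow> J \<le> R n \<omega> \<and> J \<le> B n \<omega>" for n \<omega>
  have G_sets: "{\<omega> \<in> space M. G n \<omega>} \<in> sets M" for n
    unfolding G_def by (rule sets_hist[where n = n]) (auto simp: hist_eq_iff)

  have mart_eq: "mart n \<omega> = (\<Sum>m<n. (real (R (Suc m) \<omega>) - real (R m \<omega>)) * f (R m \<omega>))
      - (\<Sum>m<n. (real (B (Suc m) \<omega>) - real (B m \<omega>)) * f (B m \<omega>))" for n \<omega>
    unfolding mart_def f_def by (rule sum_subtractf)
  have qvar_eq: "qvar n \<omega> = (\<Sum>m<n. (real (R (Suc m) \<omega>) - real (R m \<omega>)) * f2 (R m \<omega>))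
      + (\<Sum>m<n. (real (B (Suc m) \<omega>) - real (B m \<omega>)) * f2 (B m \<omega>))" for n \<omega>
    unfolding qvar_def f2_def by (rule sum.distrib)
  have bounds: "sum g {X 0 \<omega>..<X n \<omega>} \<le> (\<Sum>m<n. (real (X (Suc m) \<omega>) - real (X m \<omega>)) * g (X m \<omega>))"
    "(\<Sum>m<n. (real (X (Suc m) \<omega>) - real (X m \<omega>)) * g (X m \<omega>)) \<le> sum g {X 0 \<omega>..<X n \<omega>} + real S * (g (X 0 \<omega>) - g (X n \<omega>))"
    if "regular \<omega>" "X = R \<or> X = B" "g = f \<or> g = f2" for \<omega> X g n
    using that regular_Suc[OF that(1)] regular_jump[OF that(1)] anti
    by (intro sum_increments_bounds[of g "\<lambda>m. X m \<omega>"]; blast)+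
  have drop: "real S * (a - b) \<le> real S * c" if "0 \<le> b" "a \<le> c" for a b c
    using that by (intro mult_left_mono) auto

  \<comment> \<open>The two batch errors add at most \<open>2 * (real S * \<delta>)^2\<close>, which
    the spread hypothesis bounds by V / 16.\<close>
  have U_le: "qvar n \<omega> \<le> 2 * V" if reg: "regular \<omega>" for n \<omega>
  proof -
    have "(\<Sum>m<n. (real (R (Suc m) \<omega>) - real (R m \<omega>)) * f2 (R m \<omega>)) \<le> (\<Sum>k. f2 (k + r\<^sub>0)) + real S * \<delta>\<^sup>2"
      using bounds(2)[OF reg, of R f2 n] J3(2)[of "R n \<omega>"] drop[OF f_pos(2) f2_le(1), of "R n \<omega>"]
      by (simp add: regular_0[OF reg])
    moreover have "(\<Sum>m<n. (real (B (Suc m) \<omega>) - real (B m \<omega>)) * f2 (B m \<omega>)) \<le> (\<Sum>k. f2 (k + b\<^sub>0)) + real S * \<delta>\<^sup>2"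
      using bounds(2)[OF reg, of B f2 n] J4(2)[of "B n \<omega>"] drop[OF f_pos(2) f2_le(2), of "B n \<omega>"]
      by (simp add: regular_0[OF reg])
    moreover have "real S * \<delta>\<^sup>2 \<le> (real S * \<delta>)\<^sup>2"
    proof -
      have "real S * \<delta>\<^sup>2 * 1 \<le> real S * \<delta>\<^sup>2 * real S" using S1 by (intro mult_left_mono) auto
      then show ?thesis by (simp add: power2_eq_square mult_ac)
    qed
    ultimately show ?thesis using KV V unfolding qvar_eq mult_2 V_eq by linarith
  qed
  have on_G: "V / 2 \<le> qvar n \<omega>" "(mart n \<omega> - x)\<^sup>2 \<le> 4 * (real S * \<delta>)\<^sup>2"
    if reg: "regular \<omega>" and G: "G n \<omega>" for n \<omega>
  proof -
    have J': "J1 \<le> R n \<omega>" "J3 \<le> R n \<omega>" "J2 \<le> B n \<omega>" "J4 \<le> B n \<omega>"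
      using G J by (auto simp: G_def)
    show "V / 2 \<le> qvar n \<omega>"
      using bounds(1)[OF reg, of R f2 n, simplified] bounds(1)[OF reg, of B f2 n, simplified]
        J3(1)[OF J'(2)] J4(1)[OF J'(4)] V_eq
      unfolding qvar_eq regular_0[OF reg] by linarith
    have r: "(\<Sum>k. f (k + r\<^sub>0)) - e \<le> (\<Sum>m<n. (real (R (Suc m) \<omega>) - real (R m \<omega>)) * f (R m \<omega>))"
      "(\<Sum>m<n. (real (R (Suc m) \<omega>) - real (R m \<omega>)) * f (R m \<omega>)) \<le> (\<Sum>k. f (k + r\<^sub>0)) + e"
      using bounds[OF reg, of R f n] J1(1)[OF J'(1)] J1(2)[of "R n \<omega>"] drop[OF f_pos(1) f_le(1), of "R n \<omega>"]
      by (simp_all add: regular_0[OF reg] e_def)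
    have b: "(\<Sum>k. f (k + b\<^sub>0)) - e \<le> (\<Sum>m<n. (real (B (Suc m) \<omega>) - real (B m \<omega>)) * f (B m \<omega>))"
      "(\<Sum>m<n. (real (B (Suc m) \<omega>) - real (B m \<omega>)) * f (B m \<omega>)) \<le> (\<Sum>k. f (k + b\<^sub>0)) + e"
      using bounds[OF reg, of B f n] J2(1)[OF J'(3)] J2(2)[of "B n \<omega>"] drop[OF f_pos(1) f_le(2), of "B n \<omega>"]
      by (simp_all add: regular_0[OF reg] e_def)
    have "\<bar>mart n \<omega> - x\<bar> \<le> 2 * e"
      using r b unfolding mart_eq x_def by linarith
    then have "(mart n \<omega> - x)\<^sup>2 \<le> (2 * e)\<^sup>2" using e by (intro abs_le_square_iff[THEN iffD1]) simp
    then show "(mart n \<omega> - x)\<^sup>2 \<le> 4 * (real S * \<delta>)\<^sup>2" by (simp add: e_def power_mult_distrib)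
  qed

  \<comment> \<open>It suffices to bound events at a single time. The contradiction compares two
    estimates of the second moment of \<open>mart n - x\<close>: at least
    \<open>x^2 + V / 2 * p\<close> by the variance, and little more than V / 8 if \<open>G n\<close>
    were nearly certain.\<close>
  have pG: "\<P>(\<omega> in M. G n \<omega>) \<le> 1 - 1 / 60800" for n
  proof (rule ccontr)
    define p where "p = \<P>(\<omega> in M. G n \<omega>)"
    assume "\<not> \<P>(\<omega> in M. G n \<omega>) \<le> 1 - 1 / 60800"
    then have p: "1 - 1 / 60800 < p" by (simp add: p_def)
    define g :: "'a \<Rightarrow> real" where "g \<omega> = (if G n \<omega> then 1 else 0)" for \<omega>
    have g_hist: "g \<omega> = g \<omega>'" if "hist n \<omega> = hist n \<omega>'" for \<omega> \<omega>'
      using hist_eqD[OF that, of n] by (simp add: g_def G_def)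
    have int: "integrable M (\<lambda>\<omega>. F (mart n \<omega>) (qvar n \<omega>) (g \<omega>))" for F :: "real \<Rightarrow> real \<Rightarrow> real \<Rightarrow> real"
      by (rule integrable_hist[where n = n]) (metis mart_hist g_hist)
    have Eg: "expectation g = p"
    proof -
      have "expectation g = expectation (indicator {\<omega> \<in> space M. G n \<omega>})"
        by (intro Bochner_Integration.integral_cong) (auto simp: g_def)
      then show ?thesis using G_sets[of n] by (simp add: p_def)
    qed
    have EU: "V / 2 * p \<le> expectation (qvar n)" "expectation (qvar n) \<le> 2 * V"
    proof -
      have "expectation (\<lambda>\<omega>. V / 2 * g \<omega>) \<le> expectation (qvar n)"
      proof (rule integral_mono_AE)
        show "AE \<omega> in M. V / 2 * g \<omega> \<le> qvar n \<omega>"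
          using AE_regular
        proof eventually_elim
          case (elim \<omega>)
          then show ?case using on_G(1)[of \<omega> n] regular_qvar_nonneg[of \<omega> n] by (simp add: g_def)
        qed
      qed (use int[of "\<lambda>m u g. V / 2 * g"] int[of "\<lambda>m u g. u"] in auto)
      then show "V / 2 * p \<le> expectation (qvar n)" by (simp add: Eg)
      have "expectation (qvar n) \<le> expectation (\<lambda>\<omega>. 2 * V)"
        using AE_regular int[of "\<lambda>m u g. u"] U_le by (intro integral_mono_AE) auto
      then show "expectation (qvar n) \<le> 2 * V" by (simp add: prob_space)
    qed
    have EZ2: "expectation (\<lambda>\<omega>. (mart n \<omega> - x)\<^sup>2) = x\<^sup>2 + expectation (qvar n)"
    proof -
      have "expectation (\<lambda>\<omega>. (mart n \<omega> - x)\<^sup>2) = expectation (\<lambda>\<omega>. (mart n \<omega>)\<^sup>2 - 2 * x * mart n \<omega> + x\<^sup>2)"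
        by (simp add: power2_diff algebra_simps)
      also have "\<dots> = expectation (\<lambda>\<omega>. (mart n \<omega>)\<^sup>2) - 2 * x * expectation (mart n) + x\<^sup>2"
        using int[of "\<lambda>m u g. m\<^sup>2"] int[of "\<lambda>m u g. m"] by (simp add: prob_space)
      finally show ?thesis by (simp add: expectation_mart expectation_mart_square)
    qed
    \<comment> \<open>Since \<open>qvar\<close> is at most 2 V, the fourth moment of
      \<open>mart\<close> is at most 8 * 4 + 11 * 4 = 76 times \<open>V^2\<close>; the factor 8 for
      subtracting x makes this 608.\<close>
    have EZ4: "expectation (\<lambda>\<omega>. (mart n \<omega> - x) ^ 4) \<le> 608 * W\<^sup>2"
    proof -
      have "expectation (\<lambda>\<omega>. (mart n \<omega>)\<^sup>2 * qvar n \<omega>) \<le> expectation (\<lambda>\<omega>. 2 * V * (mart n \<omega>)\<^sup>2)"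
      proof (rule integral_mono_AE)
        show "AE \<omega> in M. (mart n \<omega>)\<^sup>2 * qvar n \<omega> \<le> 2 * V * (mart n \<omega>)\<^sup>2"
          using AE_regular
        proof eventually_elim
          case (elim \<omega>)
          show ?case using mult_left_mono[OF U_le[OF elim, of n] zero_le_power2[of "mart n \<omega>"]]
            by (simp add: mult.commute)
        qed
      qed (use int[of "\<lambda>m u g. m\<^sup>2 * u"] int[of "\<lambda>m u g. 2 * V * m\<^sup>2"] in auto)
      also have "\<dots> = 2 * V * expectation (qvar n)" by (simp add: expectation_mart_square)
      also have "\<dots> \<le> 2 * V * (2 * V)" using EU V by (intro mult_left_mono) auto
      finally have a: "expectation (\<lambda>\<omega>. (mart n \<omega>)\<^sup>2 * qvar n \<omega>) \<le> 4 * V\<^sup>2" by (simp add: power2_eq_square)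
      have "expectation (\<lambda>\<omega>. (qvar n \<omega>)\<^sup>2) \<le> expectation (\<lambda>\<omega>. (2 * V)\<^sup>2)"
      proof (rule integral_mono_AE)
        show "AE \<omega> in M. (qvar n \<omega>)\<^sup>2 \<le> (2 * V)\<^sup>2"
          using AE_regular by eventually_elim (intro power_mono U_le regular_qvar_nonneg)
      qed (use int[of "\<lambda>m u g. u\<^sup>2"] in auto)
      then have b: "expectation (\<lambda>\<omega>. (qvar n \<omega>)\<^sup>2) \<le> 4 * V\<^sup>2" by (simp add: prob_space power_mult_distrib)
      have "expectation (\<lambda>\<omega>. (mart n \<omega> - x) ^ 4) \<le> expectation (\<lambda>\<omega>. 8 * (mart n \<omega>) ^ 4 + 8 * x ^ 4)"
      proof (rule integral_mono)
        fix \<omega>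
        define m where "m = mart n \<omega>"
        have "8 * m ^ 4 + 8 * x ^ 4 - (m - x) ^ 4 = (m + x) ^ 4 + 6 * (m\<^sup>2 - x\<^sup>2)\<^sup>2" by algebra
        moreover have "0 \<le> (m + x) ^ 4" by simp
        ultimately show "(mart n \<omega> - x) ^ 4 \<le> 8 * (mart n \<omega>) ^ 4 + 8 * x ^ 4"
          unfolding m_def[symmetric] using zero_le_power2[of "m\<^sup>2 - x\<^sup>2"] by linarith
      qed (use int[of "\<lambda>m u g. (m - x) ^ 4"] int[of "\<lambda>m u g. 8 * m ^ 4 + 8 * x ^ 4"] in auto)
      also have "\<dots> = 8 * expectation (\<lambda>\<omega>. (mart n \<omega>) ^ 4) + 8 * x ^ 4"
        using int[of "\<lambda>m u g. m ^ 4"] by (simp add: prob_space)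
      also have "\<dots> \<le> 8 * (76 * V\<^sup>2) + 8 * x ^ 4"
        using expectation_mart_fourth[of n] a b by linarith
      also have "\<dots> \<le> 608 * W\<^sup>2"
      proof -
        have "608 * W\<^sup>2 = 608 * x ^ 4 + 1216 * (x\<^sup>2 * V) + 608 * V\<^sup>2"
          unfolding W_def by algebra
        moreover have "0 \<le> x ^ 4" "0 \<le> x\<^sup>2 * V" using V by simp_all
        ultimately show ?thesis by linarith
      qed
      finally show ?thesis .
    qed
    have W: "0 < W" using V by (simp add: W_def add_nonneg_pos)
    \<comment> \<open>On \<open>G n\<close> the spread hypothesis gives
      \<open>z^2 \<le> V / 8\<close>. Off \<open>G n\<close> this is Young's inequality
      \<open>z^2 \<le> z^4 / (2 * c) + c / 2\<close> with c = 6080 W. As 12160 = 20 * 608, the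
      fourth moment contributes W / 20; the choice 60800 = 20 * 3040 makes the last term contribute
      W / 20 as well.\<close>
    have "expectation (\<lambda>\<omega>. (mart n \<omega> - x)\<^sup>2) \<le>
      expectation (\<lambda>\<omega>. V / 8 + (mart n \<omega> - x) ^ 4 / (12160 * W) + 3040 * W * (1 - g \<omega>))"
    proof (rule integral_mono_AE)
      show "AE \<omega> in M. (mart n \<omega> - x)\<^sup>2 \<le> V / 8 + (mart n \<omega> - x) ^ 4 / (12160 * W) + 3040 * W * (1 - g \<omega>)"
        using AE_regular
      proof eventually_elim
        case (elim \<omega>)
        define z where "z = mart n \<omega> - x"
        have z4: "0 \<le> z ^ 4 / (12160 * W)" using W by simp
        show ?case
        proof (cases "G n \<omega>")
          case True
          then have "z\<^sup>2 \<le> V / 8" using on_G(2)[OF elim True] KV unfolding z_def by linarith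
          then show ?thesis using z4 True by (simp add: z_def g_def)
        next
          case False
          have "z ^ 4 / (12160 * W) + 3040 * W - z\<^sup>2 = (z\<^sup>2 - 6080 * W)\<^sup>2 / (12160 * W)"
            using W by (simp add: field_simps power2_diff) algebra
          also have "\<dots> \<ge> 0" using W by simp
          finally show ?thesis using False V by (simp add: z_def g_def)
        qed
      qed
    qed (use int[of "\<lambda>m u g. (m - x)\<^sup>2"] int[of "\<lambda>m u g. V / 8 + (m - x) ^ 4 / (12160 * W) + 3040 * W * (1 - g)"] in auto)
    also have "\<dots> = V / 8 + expectation (\<lambda>\<omega>. (mart n \<omega> - x) ^ 4) / (12160 * W) + 3040 * W * (1 - p)"
      using int[of "\<lambda>m u g. (m - x) ^ 4"] int[of "\<lambda>m u g. g"] by (simp add: prob_space Eg)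
    also have "\<dots> \<le> V / 8 + W / 20 + 3040 * W * (1 / 60800)"
    proof (intro add_mono mult_left_mono)
      have "expectation (\<lambda>\<omega>. (mart n \<omega> - x) ^ 4) / (12160 * W) \<le> 608 * W\<^sup>2 / (12160 * W)"
        using EZ4 W by (intro divide_right_mono) auto
      then show "expectation (\<lambda>\<omega>. (mart n \<omega> - x) ^ 4) / (12160 * W) \<le> W / 20"
        using W by (simp add: power2_eq_square)
    qed (use p W in auto)
    finally have "x\<^sup>2 + V / 2 * p \<le> V / 8 + W / 10" using EU(1) unfolding EZ2 by simp
    moreover have "V / 2 * (1 - 1 / 60800) \<le> V / 2 * p" using p V by (intro mult_left_mono) auto
    moreover have "V / 2 * (1 - 1 / 60800) = 60799 / 121600 * V" by simp
    moreover have "W / 10 = x\<^sup>2 / 10 + V / 10" by (simp add: W_def add_divide_distrib)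
    ultimately show False using V zero_le_power2[of x] by linarith
  qed
  show ?thesis
  proof (rule prob_eventually_le[where P = G])
    show "{\<omega> \<in> space M. both_infinite R B \<omega>} \<subseteq> {\<omega> \<in> space M. \<exists>N. \<forall>n\<ge>N. G n \<omega>}"
      by (auto simp: both_infinite_def G_def)
  qed (rule G_sets, rule pG)
qed

text \<open>The event is avoided if the smaller colour never grows. Choosing the smaller one makes
  the tail from \<open>b\<^sub>0\<close> at most the tail from \<open>r\<^sub>0\<close>, so the
  bound involves a single starting count.\<close>

lemma prob_both_infinite_le_of_le:
  assumes sm: "summable (\<lambda>k. 1 / w k)" and le: "r\<^sub>0 \<le> b\<^sub>0"
  shows "\<P>(\<omega> in M. both_infinite R B \<omega>) \<le> 1 - exp (- (real S * w r\<^sub>0 * (\<Sum>k. 1 / w (k + r\<^sub>0))))"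
proof -
  have N: "{\<omega> \<in> space M. \<forall>n. R n \<omega> = r\<^sub>0} \<in> sets M"
  proof (rule sets.sets_Collect_countable_All)
    show "{\<omega> \<in> space M. R n \<omega> = r\<^sub>0} \<in> sets M" for n
      by (rule sets_hist[where n = n]) (auto simp: hist_eq_iff)
  qed
  have sms: "summable (\<lambda>k. 1 / w (k + j))" for j
    using summable_iff_shift[of "\<lambda>k. 1 / w k" j] sm by simp
  have "(\<Sum>k. 1 / w (k + b\<^sub>0)) \<le> (\<Sum>k. 1 / w (k + r\<^sub>0))"
    using le by (intro suminf_le sms inverse_w_antimono) auto
  then have "real S * w r\<^sub>0 * (\<Sum>k. 1 / w (k + b\<^sub>0)) \<le> real S * w r\<^sub>0 * (\<Sum>k. 1 / w (k + r\<^sub>0))"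
    using w_pos[of r\<^sub>0] by (intro mult_left_mono) auto
  then have "exp (- (real S * w r\<^sub>0 * (\<Sum>k. 1 / w (k + r\<^sub>0)))) \<le> \<P>(\<omega> in M. \<forall>n. R n \<omega> = r\<^sub>0)"
    by (intro order_trans[OF _ prob_never_red_ge[OF sm]]) simp
  moreover have "\<not> both_infinite R B \<omega>" if "\<forall>n. R n \<omega> = r\<^sub>0" for \<omega>
  proof
    assume "both_infinite R B \<omega>"
    then obtain N where "\<forall>n\<ge>N. Suc r\<^sub>0 \<le> R n \<omega> \<and> Suc r\<^sub>0 \<le> B n \<omega>" unfolding both_infinite_def by blast
    then have "Suc r\<^sub>0 \<le> R N \<omega>" by blast
    then show False using that by simp
  qed
  then have "\<P>(\<omega> in M. both_infinite R B \<omega>) \<le> prob (space M - {\<omega> \<in> space M. \<forall>n. R n \<omega> = r\<^sub>0})"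
    using N by (intro finite_measure_mono) auto
  ultimately show ?thesis using N by (simp add: prob_compl)
qed

end

lemma (in bounded_gpu) prob_both_infinite_le:
  assumes sm: "summable (\<lambda>k. 1 / w k)"
  shows "\<P>(\<omega> in M. both_infinite R B \<omega>) \<le>
    1 - exp (- (real S * w (min r\<^sub>0 b\<^sub>0) * (\<Sum>k. 1 / w (k + min r\<^sub>0 b\<^sub>0))))"
proof (cases "r\<^sub>0 \<le> b\<^sub>0")
  case True
  then show ?thesis using prob_both_infinite_le_of_le[OF sm] by (simp add: min_def)
next
  case False
  interpret swapped: bounded_gpu M w \<sigma> b\<^sub>0 r\<^sub>0 B R S by (rule swap)
  show ?thesis
    using False swapped.prob_both_infinite_le_of_le[OF sm]
    by (simp add: min_def both_infinite_commute[of B R])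
qed

section \<open>Both colours infinite: concentration on histories\<close>

context bounded_gpu
begin

text \<open>A conditional probability of an event can be made close to 1 by conditioning on a suitable
  history, and here the history may be chosen to end when both colours first reach a given level.\<close>

lemma both_infinite_concentrates:
  assumes pos: "0 < \<P>(\<omega> in M. both_infinite R B \<omega>)" and \<epsilon>: "0 < \<epsilon>" "\<epsilon> \<le> 1"
  obtains J\<^sub>0 where "\<And>J. J\<^sub>0 \<le> J \<Longrightarrow> \<exists>n h. 0 < \<P>(\<omega> in M. hist n \<omega> = h) \<and>
      J \<le> min (fst (h ! n)) (snd (h ! n)) \<and> min (fst (h ! n)) (snd (h ! n)) \<le> J + S \<and>
      (1 - \<epsilon>) * \<P>(\<omega> in M. hist n \<omega> = h) < \<P>(\<omega> in M. both_infinite R B \<omega> \<and> hist n \<omega> = h)"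
proof -
  define A where "A = {\<omega> \<in> space M. both_infinite R B \<omega>}"
  \<comment> \<open>\<open>G J\<close> decreases to \<open>A\<close> up to a null set, so for large
    J the event \<open>A\<close> fills more than the fraction 1 - \<epsilon> of
    \<open>G J\<close>.\<close>
  define G where "G J = {\<omega> \<in> space M. \<exists>n. J \<le> R n \<omega> \<and> J \<le> B n \<omega>}" for J
  have A_sets: "A \<in> sets M" unfolding A_def by (rule sets_both_infinite)
  have hit_sets: "{\<omega> \<in> space M. J \<le> R n \<omega> \<and> J \<le> B n \<omega>} \<in> sets M" for J n
    by (rule sets_hist[where n = n]) (auto simp: hist_eq_iff)
  have G_sets: "G J \<in> sets M" for J
    unfolding G_def by (rule sets.sets_Collect_countable_Ex) (rule hit_sets)
  have AG: "A \<subseteq> G J" for J by (auto simp: A_def G_def both_infinite_def)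
  have "prob (\<Inter>J. G J) = prob A"
  proof (rule finite_measure_eq_AE)
    show "AE \<omega> in M. \<omega> \<in> (\<Inter>J. G J) \<longleftrightarrow> \<omega> \<in> A"
      using AE_regular AE_space
    proof eventually_elim
      case (elim \<omega>)
      have "both_infinite R B \<omega>" if hit: "\<And>J. \<exists>n. J \<le> R n \<omega> \<and> J \<le> B n \<omega>"
        unfolding both_infinite_def
      proof
        fix J
        obtain N where "J \<le> R N \<omega>" "J \<le> B N \<omega>" using hit by blast
        then show "\<exists>N. \<forall>n\<ge>N. J \<le> R n \<omega> \<and> J \<le> B n \<omega>"
          using regular_mono[OF elim(1)] by (meson order_trans)
      qed
      then show ?case using elim AG by (auto simp: G_def A_def)
    qed
  qed (use G_sets A_sets in auto)
  moreover have "(\<lambda>J. prob (G J)) \<longlonglongrightarrow> prob (\<Inter>J. G J)"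
  proof (rule finite_Lim_measure_decseq)
    show "decseq G" unfolding decseq_def G_def by (blast intro: order_trans)
  qed (use G_sets in auto)
  ultimately have lim: "(\<lambda>J. (1 - \<epsilon>) * prob (G J)) \<longlonglongrightarrow> (1 - \<epsilon>) * prob A"
    by (intro tendsto_mult_left) simp
  have posA: "0 < prob A" using pos by (simp add: A_def)
  have "(1 - \<epsilon>) * prob A < prob A" using posA \<epsilon> by (simp add: left_diff_distrib)
  then have "eventually (\<lambda>J. (1 - \<epsilon>) * prob (G J) < prob A) sequentially"
    by (rule order_tendstoD(2)[OF lim])
  then obtain J1 where J1: "\<And>J. J1 \<le> J \<Longrightarrow> (1 - \<epsilon>) * prob (G J) < prob A"
    by (auto simp: eventually_sequentially)
  \<comment> \<open>Beyond the initial counts the level cannot be reached at time 0, so a step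
    before the hitting time exists.\<close>
  define J0 where "J0 = max J1 (Suc (r\<^sub>0 + b\<^sub>0))"
  show thesis
  proof (rule that[of J0])
    fix J assume J: "J0 \<le> J"
    define hit where "hit c \<longleftrightarrow> J \<le> fst c \<and> J \<le> snd c" for c :: "nat \<times> nat"
    \<comment> \<open>The histories stopped when the level is first hit. They have different
      lengths, and their cylinders \<open>C h\<close> partition \<open>G J\<close>.\<close>
    define F where "F = {h. h \<noteq> [] \<and> hit (last h) \<and> (\<forall>i<length h - 1. \<not> hit (h ! i))}"
    define C where "C h = {\<omega> \<in> space M. hist (length h - 1) \<omega> = h}" for h
    have C_sets: "C h \<in> sets M" for h unfolding C_def by (rule sets_hist_eq)
    have C_iff: "\<omega> \<in> C h \<and> h \<in> F \<longleftrightarrow> \<omega> \<in> space M \<and> (\<exists>n. h = hist n \<omega> \<and> hit (R n \<omega>, B n \<omega>) \<and>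
        (\<forall>i<n. \<not> hit (R i \<omega>, B i \<omega>)))" for \<omega> h
    proof
      assume a: "\<omega> \<in> C h \<and> h \<in> F"
      define n where "n = length h - 1"
      have h: "h = hist n \<omega>" and sp: "\<omega> \<in> space M" using a by (auto simp: C_def n_def)
      have l: "last h = (R n \<omega>, B n \<omega>)" unfolding h by (simp add: hist_def)
      have "\<not> hit (R i \<omega>, B i \<omega>)" if "i < n" for i
      proof -
        have "\<not> hit (h ! i)" using a that by (auto simp: F_def n_def)
        then show ?thesis using nth_hist[of i n \<omega>] that unfolding h[symmetric] by simp
      qed
      then show "\<omega> \<in> space M \<and> (\<exists>n. h = hist n \<omega> \<and> hit (R n \<omega>, B n \<omega>) \<and> (\<forall>i<n. \<not> hit (R i \<omega>, B i \<omega>)))"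
        using a h l sp by (auto simp: F_def)
    next
      assume "\<omega> \<in> space M \<and> (\<exists>n. h = hist n \<omega> \<and> hit (R n \<omega>, B n \<omega>) \<and> (\<forall>i<n. \<not> hit (R i \<omega>, B i \<omega>)))"
      then obtain n where sp: "\<omega> \<in> space M" and h: "h = hist n \<omega>" and n: "hit (R n \<omega>, B n \<omega>)"
        and first: "\<And>i. i < n \<Longrightarrow> \<not> hit (R i \<omega>, B i \<omega>)" by blast
      have "last h = (R n \<omega>, B n \<omega>)" unfolding h by (simp add: hist_def)
      moreover have "length h = Suc n" by (simp add: h)
      moreover have "h ! i = (R i \<omega>, B i \<omega>)" if "i < n" for i using that by (simp add: h)
      moreover have "h \<noteq> []" by (simp add: h hist_def)
      ultimately show "\<omega> \<in> C h \<and> h \<in> F"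
        using n first sp h by (auto simp: C_def F_def)
    qed
    have disj: "disjoint_family_on C F"
      unfolding disjoint_family_on_def
    proof (intro ballI impI equals0I)
      fix h h' \<omega> assume "h \<in> F" "h' \<in> F" "h \<noteq> h'" "\<omega> \<in> C h \<inter> C h'"
      then obtain n n' where n: "h = hist n \<omega>" "hit (R n \<omega>, B n \<omega>)" "\<forall>i<n. \<not> hit (R i \<omega>, B i \<omega>)"
        and n': "h' = hist n' \<omega>" "hit (R n' \<omega>, B n' \<omega>)" "\<forall>i<n'. \<not> hit (R i \<omega>, B i \<omega>)"
        using C_iff by (metis IntD1 IntD2)
      then have "n = n'" by (metis nat_neq_iff)
      then show False using n n' \<open>h \<noteq> h'\<close> by simp
    qed
    have UN: "(\<Union>h\<in>F. C h) = G J"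
    proof (intro set_eqI iffI)
      fix \<omega> assume "\<omega> \<in> (\<Union>h\<in>F. C h)"
      then obtain h where "\<omega> \<in> C h \<and> h \<in> F" by blast
      from iffD1[OF C_iff this] show "\<omega> \<in> G J" by (auto simp: G_def hit_def)
    next
      fix \<omega> assume \<omega>: "\<omega> \<in> G J"
      then have sp: "\<omega> \<in> space M" and "\<exists>n. hit (R n \<omega>, B n \<omega>)" by (auto simp: G_def hit_def)
      from exists_least_iff[THEN iffD1, OF this(2)]
      obtain n where n: "hit (R n \<omega>, B n \<omega>) \<and> (\<forall>i<n. \<not> hit (R i \<omega>, B i \<omega>))" by (rule exE)
      have "\<omega> \<in> C (hist n \<omega>) \<and> hist n \<omega> \<in> F"
        by (rule iffD2[OF C_iff]) (use sp n in blast)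
      then show "\<omega> \<in> (\<Union>h\<in>F. C h)" by blast
    qed
    \<comment> \<open>An averaging argument: if \<open>A\<close> filled at most the fraction 1 -
      \<epsilon> of every cylinder, it would fill at most that fraction of
      \<open>G J\<close>.\<close>
    have "\<exists>h\<in>F. (1 - \<epsilon>) * prob (C h) < prob (A \<inter> C h)"
    proof (rule ccontr)
      assume "\<not> (\<exists>h\<in>F. (1 - \<epsilon>) * prob (C h) < prob (A \<inter> C h))"
      then have le: "prob (A \<inter> C h) \<le> (1 - \<epsilon>) * prob (C h)" if "h \<in> F" for h
        using that by (simp add: not_less)
      have "emeasure M A = emeasure M (\<Union>h\<in>F. A \<inter> C h)"
        using AG[of J] UN by (intro arg_cong[where f = "emeasure M"]) auto
      also have "\<dots> = (\<integral>\<^sup>+h. emeasure M (A \<inter> C h) \<partial>count_space F)"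
        using disj A_sets C_sets
        by (intro emeasure_UN_countable) (auto simp: disjoint_family_on_def)
      also have "\<dots> \<le> (\<integral>\<^sup>+h. ennreal (1 - \<epsilon>) * emeasure M (C h) \<partial>count_space F)"
      proof (rule nn_integral_mono)
        fix h assume "h \<in> space (count_space F)"
        then show "emeasure M (A \<inter> C h) \<le> ennreal (1 - \<epsilon>) * emeasure M (C h)"
          using le[of h] \<epsilon> by (simp add: emeasure_eq_measure ennreal_mult'[symmetric] ennreal_leI)
      qed
      also have "\<dots> = ennreal (1 - \<epsilon>) * (\<integral>\<^sup>+h. emeasure M (C h) \<partial>count_space F)"
        by (rule nn_integral_cmult) simp
      also have "(\<integral>\<^sup>+h. emeasure M (C h) \<partial>count_space F) = emeasure M (\<Union>h\<in>F. C h)"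
        using disj C_sets by (intro emeasure_UN_countable[symmetric]) auto
      also have "ennreal (1 - \<epsilon>) * \<dots> = ennreal ((1 - \<epsilon>) * prob (G J))"
        using \<epsilon> by (simp add: UN emeasure_eq_measure ennreal_mult')
      finally have "prob A \<le> (1 - \<epsilon>) * prob (G J)"
        using \<epsilon> by (simp add: emeasure_eq_measure)
      then show False using J1[of J] J by (simp add: J0_def)
    qed
    then obtain h where h: "h \<in> F" and big: "(1 - \<epsilon>) * prob (C h) < prob (A \<inter> C h)" by blast
    define n where "n = length h - 1"
    have len: "length h = Suc n" using h by (auto simp: F_def n_def)
    have Ch: "C h = {\<omega> \<in> space M. hist n \<omega> = h}" by (simp add: C_def n_def)
    have posC: "0 < prob (C h)"
    proof -
      have "0 \<le> (1 - \<epsilon>) * prob (C h)" using \<epsilon> by simp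
      also note big
      also have "prob (A \<inter> C h) \<le> prob (C h)" using C_sets by (intro finite_measure_mono) auto
      finally show ?thesis .
    qed
    \<comment> \<open>A regular path through the cylinder transfers the jump bound to the list
      h.\<close>
    have "\<exists>\<omega>\<in>C h. regular \<omega>"
    proof (rule ccontr)
      assume "\<not> (\<exists>\<omega>\<in>C h. regular \<omega>)"
      then have "AE \<omega> in M. \<omega> \<notin> C h" using AE_regular by (auto elim: eventually_mono)
      then have "prob (C h) = 0" using C_sets by (simp add: prob_eq_0)
      then show False using posC by simp
    qed
    then obtain \<omega> where \<omega>: "\<omega> \<in> C h" and reg: "regular \<omega>" by blast
    have hn: "hist n \<omega> = h" using \<omega> by (simp add: Ch)
    have hi: "h ! i = (R i \<omega>, B i \<omega>)" if "i \<le> n" for i using nth_hist[OF that, of \<omega>] by (simp add: hn)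
    have hit_n: "hit (h ! n)" using h len by (auto simp: F_def last_conv_nth)
    have "n \<noteq> 0"
    proof
      assume "n = 0"
      then show False using hit_n J regular_0[OF reg] by (simp add: hi hit_def J0_def)
    qed
    then obtain m where m: "n = Suc m" by (cases n) auto
    \<comment> \<open>One step earlier some colour was still below J, and it gained at most
      S.\<close>
    have "\<not> hit (h ! m)" using h len m by (auto simp: F_def)
    then have "min (R n \<omega>) (B n \<omega>) \<le> J + S"
      using regular_jump[OF reg, of m] by (auto simp: hi hit_def m)
    moreover have "J \<le> min (R n \<omega>) (B n \<omega>)" using hit_n by (simp add: hi hit_def)
    moreover have "A \<inter> C h = {\<omega> \<in> space M. both_infinite R B \<omega> \<and> hist n \<omega> = h}"
      by (auto simp: A_def Ch)
    ultimately show "\<exists>n h. 0 < \<P>(\<omega> in M. hist n \<omega> = h) \<and>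
      J \<le> min (fst (h ! n)) (snd (h ! n)) \<and> min (fst (h ! n)) (snd (h ! n)) \<le> J + S \<and>
      (1 - \<epsilon>) * \<P>(\<omega> in M. hist n \<omega> = h) < \<P>(\<omega> in M. both_infinite R B \<omega> \<and> hist n \<omega> = h)"
      using posC big unfolding Ch by (intro exI[of _ n] exI[of _ h]) (simp add: hi)
  qed
qed

text \<open>Concentration is used twice: with \<epsilon> = 1 / 60800 at every high level, to refute
  the spread hypothesis there, and then with an \<epsilon> fitted to the chance of never growing
  that the resulting decay provides.\<close>

theorem prob_both_infinite_eq_0:
  assumes sm: "summable (\<lambda>k. 1 / w k)"
  shows "\<P>(\<omega> in M. both_infinite R B \<omega>) = 0"
proof (rule ccontr)
  assume "\<P>(\<omega> in M. both_infinite R B \<omega>) \<noteq> 0"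
  then have pos: "0 < \<P>(\<omega> in M. both_infinite R B \<omega>)" by (simp add: zero_less_measure_iff)
  have cond: "\<P>(\<omega> in uniform_measure M {\<omega> \<in> space M. hist n \<omega> = h}.
        both_infinite (\<lambda>m. R (n + m)) (\<lambda>m. B (n + m)) \<omega>) > 1 - \<epsilon>"
    if "0 < \<P>(\<omega> in M. hist n \<omega> = h)"
      "(1 - \<epsilon>) * \<P>(\<omega> in M. hist n \<omega> = h) < \<P>(\<omega> in M. both_infinite R B \<omega> \<and> hist n \<omega> = h)" for n h \<epsilon>
    unfolding both_infinite_shift prob_uniform_hist[OF sets_both_infinite]
    using that by (simp add: pos_less_divide_eq)
  \<comment> \<open>The term with 32 comes from the failure of the spread hypothesis at the level g
    actually reached; the summand S pays for the at most S terms between k and g.\<close>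
  define K where "K = real S + 32 * (real S)\<^sup>2"
  have S1: "1 \<le> real S" using S_pos by linarith
  have K: "1 < K" using S1 zero_less_power[of "real S" 2] unfolding K_def by linarith
  obtain J1 where J1: "\<And>J. J1 \<le> J \<Longrightarrow> \<exists>n h. 0 < \<P>(\<omega> in M. hist n \<omega> = h) \<and>
      J \<le> min (fst (h ! n)) (snd (h ! n)) \<and> min (fst (h ! n)) (snd (h ! n)) \<le> J + S \<and>
      (1 - 1 / 60800) * \<P>(\<omega> in M. hist n \<omega> = h) < \<P>(\<omega> in M. both_infinite R B \<omega> \<and> hist n \<omega> = h)"
    using both_infinite_concentrates[OF pos, of "1 / 60800"] by auto
  have sm2: "summable (\<lambda>j. (1 / w (j + k))\<^sup>2)" for k
    using summable_iff_shift[of "\<lambda>j. (1 / w j)\<^sup>2" k] summable_square[OF sm] by simp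
  have tail: "(\<Sum>j. (1 / w (j + k))\<^sup>2) \<le> K * (1 / w k)\<^sup>2" if k: "J1 \<le> k" for k
  proof -
    obtain n h where h: "0 < \<P>(\<omega> in M. hist n \<omega> = h)"
      "k \<le> min (fst (h ! n)) (snd (h ! n))" "min (fst (h ! n)) (snd (h ! n)) \<le> k + S"
      "(1 - 1 / 60800) * \<P>(\<omega> in M. hist n \<omega> = h) < \<P>(\<omega> in M. both_infinite R B \<omega> \<and> hist n \<omega> = h)"
      using J1[OF k] by blast
    define g where "g = min (fst (h ! n)) (snd (h ! n))"
    interpret sh: bounded_gpu "uniform_measure M {\<omega> \<in> space M. hist n \<omega> = h}" w "\<lambda>m. \<sigma> (n + m)"
      "fst (h ! n)" "snd (h ! n)" "\<lambda>m. R (n + m)" "\<lambda>m. B (n + m)" S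
      by (rule shift[OF h(1)])
    \<comment> \<open>Otherwise the restarted urn would make both colours infinite with probability
      at most 1 - 1 / 60800, against the choice of h.\<close>
    have "square_tail (fst (h ! n)) + square_tail (snd (h ! n)) < 32 * (real S)\<^sup>2 * (1 / w g)\<^sup>2"
    proof (rule ccontr)
      assume "\<not> ?thesis"
      then show False
        using sh.prob_both_infinite_le_of_spread[OF sm] cond[OF h(1,4)] by (simp add: g_def)
    qed
    moreover have "square_tail g \<le> square_tail (fst (h ! n)) + square_tail (snd (h ! n))"
      using square_tail_pos[OF sm, of "fst (h ! n)"] square_tail_pos[OF sm, of "snd (h ! n)"]
      by (simp add: g_def min_def)
    ultimately have g: "square_tail g \<le> 32 * (real S)\<^sup>2 * (1 / w g)\<^sup>2" by linarith
    have sq_anti: "(1 / w j)\<^sup>2 \<le> (1 / w k)\<^sup>2" if "k \<le> j" for j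
      using inverse_w_antimono[OF that] w_pos[of j] by (intro power_mono) (auto simp: less_imp_le)
    define d where "d = g - k"
    have d: "g = d + k" "d \<le> S" using h(2,3) by (auto simp: d_def g_def)
    have "(\<Sum>j. (1 / w (j + k))\<^sup>2) = square_tail g + (\<Sum>j<d. (1 / w (j + k))\<^sup>2)"
      using suminf_split_initial_segment[OF sm2[of k], of d] by (simp add: square_tail_def d(1) add.assoc)
    also have "(\<Sum>j<d. (1 / w (j + k))\<^sup>2) \<le> real d * (1 / w k)\<^sup>2"
      using sum_bounded_above[of "{..<d}" "\<lambda>j. (1 / w (j + k))\<^sup>2" "(1 / w k)\<^sup>2"] sq_anti by simp
    also have "real d * (1 / w k)\<^sup>2 \<le> real S * (1 / w k)\<^sup>2" using d by (intro mult_right_mono) auto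
    also have "square_tail g \<le> 32 * (real S)\<^sup>2 * (1 / w k)\<^sup>2"
      using sq_anti[of g] d by (intro order_trans[OF g] mult_left_mono) auto
    finally show ?thesis by (simp add: K_def distrib_right)
  qed
  define Q where "Q = sqrt K / (1 - sqrt (1 - 1 / K))"
  have decay: "w k * (\<Sum>j. 1 / w (j + k)) \<le> Q" if "J1 \<le> k" for k
  proof -
    have "(\<Sum>j. 1 / w (j + k)) \<le> Q * (1 / w k)"
      unfolding Q_def
      using suminf_geometric_decay[of "\<lambda>j. 1 / w j" K k] w_pos K summable_square[OF sm] tail that by simp
    then show ?thesis using w_pos[of k] by (simp add: field_simps)
  qed
  \<comment> \<open>A lower bound, common to all restarts from counts of at least J1, for the chance
    that the smaller colour never grows.\<close>
  define \<epsilon> where "\<epsilon> = exp (- (real S * Q))"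
  have "0 < w J1 * (\<Sum>j. 1 / w (j + J1))"
    using w_pos summable_iff_shift[of "\<lambda>k. 1 / w k" J1] sm
    by (intro mult_pos_pos suminf_pos) auto
  then have "0 \<le> Q" using decay[of J1] by simp
  then have \<epsilon>: "0 < \<epsilon>" "\<epsilon> \<le> 1" by (auto simp: \<epsilon>_def)
  obtain J2 where J2: "\<And>J. J2 \<le> J \<Longrightarrow> \<exists>n h. 0 < \<P>(\<omega> in M. hist n \<omega> = h) \<and>
      J \<le> min (fst (h ! n)) (snd (h ! n)) \<and> min (fst (h ! n)) (snd (h ! n)) \<le> J + S \<and>
      (1 - \<epsilon>) * \<P>(\<omega> in M. hist n \<omega> = h) < \<P>(\<omega> in M. both_infinite R B \<omega> \<and> hist n \<omega> = h)"
    using both_infinite_concentrates[OF pos \<epsilon>] by auto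
  obtain n h where h: "0 < \<P>(\<omega> in M. hist n \<omega> = h)"
    "max J1 J2 \<le> min (fst (h ! n)) (snd (h ! n))"
    "(1 - \<epsilon>) * \<P>(\<omega> in M. hist n \<omega> = h) < \<P>(\<omega> in M. both_infinite R B \<omega> \<and> hist n \<omega> = h)"
    using J2[of "max J1 J2"] by auto
  define g where "g = min (fst (h ! n)) (snd (h ! n))"
  interpret sh: bounded_gpu "uniform_measure M {\<omega> \<in> space M. hist n \<omega> = h}" w "\<lambda>m. \<sigma> (n + m)"
    "fst (h ! n)" "snd (h ! n)" "\<lambda>m. R (n + m)" "\<lambda>m. B (n + m)" S
    by (rule shift[OF h(1)])
  have "real S * (w g * (\<Sum>j. 1 / w (j + g))) \<le> real S * Q"
    using h(2) by (intro mult_left_mono decay) (auto simp: g_def)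
  then have "\<epsilon> \<le> exp (- (real S * w g * (\<Sum>j. 1 / w (j + g))))"
    by (simp add: \<epsilon>_def mult.assoc)
  moreover have "\<epsilon> > exp (- (real S * w g * (\<Sum>j. 1 / w (j + g))))"
    using sh.prob_both_infinite_le[OF sm] cond[OF h(1,3)] by (simp add: g_def)
  ultimately show False by simp
qed

end

section \<open>Limits of the counts\<close>

text \<open>On a monotone path \<open>lim\<close> is the supremum. The statement concerns one
  \<omega> because monotonicity of the urn holds only almost surely.\<close>

lemma limit_count_less_infinity_iff:
  assumes mono: "\<And>n. X n \<omega> \<le> X (Suc n) \<omega>"
  shows "limit_count X \<omega> < \<infinity> \<longleftrightarrow> \<not> (\<forall>J. \<exists>n. J \<le> X n \<omega>)"
proof -
  have "incseq (\<lambda>n. enat (X n \<omega>))" using mono by (intro incseq_SucI) simp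
  then have L: "limit_count X \<omega> = (SUP n. enat (X n \<omega>))"
    unfolding limit_count_def by (intro limI LIMSEQ_SUP)
  show ?thesis
  proof
    assume "limit_count X \<omega> < \<infinity>"
    then obtain c where c: "(SUP n. enat (X n \<omega>)) = enat c" unfolding L by (cases "SUP n. enat (X n \<omega>)") auto
    have "enat (X n \<omega>) \<le> enat c" for n unfolding c[symmetric] by (rule SUP_upper) simp
    then have "\<not> Suc c \<le> X n \<omega>" for n by (simp add: not_le less_Suc_eq_le)
    then show "\<not> (\<forall>J. \<exists>n. J \<le> X n \<omega>)" by blast
  next
    assume "\<not> (\<forall>J. \<exists>n. J \<le> X n \<omega>)"
    then obtain J where J: "X n \<omega> < J" for n by (auto simp: not_le)
    have "(SUP n. enat (X n \<omega>)) \<le> enat J" by (rule SUP_least) (use J in \<open>simp add: less_imp_le\<close>)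
    then show "limit_count X \<omega> < \<infinity>" unfolding L by (rule le_less_trans) simp
  qed
qed

text \<open>Where the counts do not converge, \<open>lim\<close> is the junk value \<open>THE L. False\<close>, so measurability
  needs the set of convergence.\<close>

lemma sets_limit_count:
  assumes X: "\<And>n. X n \<in> measurable M (count_space UNIV)"
  shows "{\<omega> \<in> space M. limit_count X \<omega> < \<infinity>} \<in> sets M"
proof -
  define const where "const \<omega> \<longleftrightarrow> (\<exists>k N. \<forall>n. N \<le> n \<longrightarrow> X n \<omega> = k)" for \<omega>
  define inf where "inf \<omega> \<longleftrightarrow> (\<forall>J. \<exists>N. \<forall>n. N \<le> n \<longrightarrow> J \<le> X n \<omega>)" for \<omega>
  have "limit_count X \<omega> < \<infinity> \<longleftrightarrow> const \<omega> \<or> (\<not> inf \<omega> \<and> (THE L :: enat. False) < \<infinity>)" for \<omega>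
  proof -
    consider (const) "const \<omega>" | (inf) "inf \<omega>" | (none) "\<not> const \<omega>" "\<not> inf \<omega>" by blast
    then show ?thesis
    proof cases
      case const
      then obtain k N where "\<And>n. N \<le> n \<Longrightarrow> X n \<omega> = k" by (auto simp: const_def)
      then have "eventually (\<lambda>n. enat (X n \<omega>) = enat k) sequentially"
        by (auto simp: eventually_sequentially)
      then have "(\<lambda>n. enat (X n \<omega>)) \<longlonglongrightarrow> enat k" by (rule tendsto_eventually)
      then show ?thesis using const by (simp add: limit_count_def limI)
    next
      case inf
      have "(\<lambda>n. enat (X n \<omega>)) \<longlonglongrightarrow> \<infinity>"
      proof (rule order_tendstoI)
        fix a :: enat assume "a < \<infinity>"
        then obtain j where j: "a = enat j" by (cases a) auto
        obtain N where "\<And>n. N \<le> n \<Longrightarrow> Suc j \<le> X n \<omega>" using inf unfolding inf_def by blast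
        then have "\<forall>n\<ge>N. a < enat (X n \<omega>)" by (auto simp: j Suc_le_eq)
        then show "eventually (\<lambda>n. a < enat (X n \<omega>)) sequentially" by (auto simp: eventually_sequentially)
      qed auto
      moreover have "\<not> const \<omega>"
      proof
        assume "const \<omega>"
        then obtain k N where k: "\<And>n. N \<le> n \<Longrightarrow> X n \<omega> = k" by (auto simp: const_def)
        obtain N' where "\<And>n. N' \<le> n \<Longrightarrow> Suc k \<le> X n \<omega>" using inf unfolding inf_def by blast
        then show False using k[of "max N N'"] by (metis Suc_n_not_le_n max.cobounded1 max.cobounded2)
      qed
      ultimately show ?thesis using inf by (simp add: limit_count_def limI)
    next
      case none
      have "\<not> (\<lambda>n. enat (X n \<omega>)) \<longlonglongrightarrow> L" for L
      proof
        assume L: "(\<lambda>n. enat (X n \<omega>)) \<longlonglongrightarrow> L"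
        show False
        proof (cases L)
          case (enat k)
          \<comment> \<open>Finite points are isolated in \<open>enat\<close>, so converging to one
            means being eventually constant.\<close>
          have "eventually (\<lambda>n. enat (X n \<omega>) \<in> {enat k}) sequentially"
            using L unfolding enat by (rule topological_tendstoD) (auto simp: open_enat)
          then show False using none(1) by (auto simp: eventually_sequentially const_def)
        next
          case infinity
          have "\<exists>N. \<forall>n. N \<le> n \<longrightarrow> J \<le> X n \<omega>" for J
          proof -
            have "eventually (\<lambda>n. enat J < enat (X n \<omega>)) sequentially"
              using L unfolding infinity by (rule order_tendstoD) simp
            then show ?thesis by (simp add: eventually_sequentially) (meson less_imp_le)
          qed
          then show False using none(2) by (simp add: inf_def)
        qed
      qed
      then have "limit_count X \<omega> = (THE L. False)" by (simp add: limit_count_def lim_def)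
      then show ?thesis using none by simp
    qed
  qed
  moreover have sX: "{\<omega> \<in> space M. P (X n \<omega>)} \<in> sets M" for P n
    using measurable_sets[OF X, of "Collect P" n] by (simp add: vimage_def Int_def conj_commute)
  have imp: "{\<omega> \<in> space M. N \<le> n \<longrightarrow> P (X n \<omega>)} \<in> sets M" for P and n N :: nat
    using sX[of P n] by (cases "N \<le> n") simp_all
  have "{\<omega> \<in> space M. const \<omega>} \<in> sets M" "{\<omega> \<in> space M. inf \<omega>} \<in> sets M"
    unfolding const_def inf_def
    by (intro sets.sets_Collect_countable_Ex sets.sets_Collect_countable_All imp)+
  then have "{\<omega> \<in> space M. const \<omega> \<or> (\<not> inf \<omega> \<and> (THE L :: enat. False) < \<infinity>)} \<in> sets M"
    by (intro sets.sets_Collect_disj sets.sets_Collect_conj sets.sets_Collect_neg) auto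
  ultimately show ?thesis by simp
qed

context bounded_gpu
begin

text \<open>If red stays bounded, it stops growing after some history. Each of these countably many
  possibilities has probability 0 by restarting the urn after that history.\<close>

lemma AE_red_unbounded:
  assumes ns: "\<not> summable (\<lambda>k. 1 / w k)"
  shows "AE \<omega> in M. \<forall>J. \<exists>n. J \<le> R n \<omega>"
proof -
  have "AE \<omega> in M. \<not> (hist n \<omega> = h \<and> (\<forall>m. R (n + m) \<omega> = fst (h ! n)))" for n h
  proof -
    have sR: "{\<omega> \<in> space M. \<forall>m. R (n + m) \<omega> = fst (h ! n)} \<in> sets M"
    proof (rule sets.sets_Collect_countable_All)
      show "{\<omega> \<in> space M. R (n + m) \<omega> = fst (h ! n)} \<in> sets M" for m
        by (rule sets_hist[where n = "n + m"]) (auto simp: hist_eq_iff)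
    qed
    have "\<P>(\<omega> in M. (\<forall>m. R (n + m) \<omega> = fst (h ! n)) \<and> hist n \<omega> = h) = 0"
    proof (cases "0 < \<P>(\<omega> in M. hist n \<omega> = h)")
      case True
      interpret sh: bounded_gpu "uniform_measure M {\<omega> \<in> space M. hist n \<omega> = h}" w "\<lambda>m. \<sigma> (n + m)"
        "fst (h ! n)" "snd (h ! n)" "\<lambda>m. R (n + m)" "\<lambda>m. B (n + m)" S
        by (rule shift[OF True])
      show ?thesis
        using sh.prob_never_red_eq_0[OF ns] True unfolding prob_uniform_hist[OF sR] by simp
    next
      case False
      then have "\<P>(\<omega> in M. hist n \<omega> = h) = 0" by (simp add: zero_less_measure_iff)
      moreover have "\<P>(\<omega> in M. (\<forall>m. R (n + m) \<omega> = fst (h ! n)) \<and> hist n \<omega> = h) \<le> \<P>(\<omega> in M. hist n \<omega> = h)"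
        by (intro finite_measure_mono) auto
      ultimately show ?thesis by (simp add: measure_le_0_iff)
    qed
    moreover have "{\<omega> \<in> space M. (\<forall>m. R (n + m) \<omega> = fst (h ! n)) \<and> hist n \<omega> = h} \<in> sets M"
      by (intro sets.sets_Collect_conj sR sets_hist_eq)
    ultimately have "{\<omega> \<in> space M. (\<forall>m. R (n + m) \<omega> = fst (h ! n)) \<and> hist n \<omega> = h} \<in> null_sets M"
      by (intro null_setsI) (auto simp: emeasure_eq_measure)
    then show ?thesis by (rule AE_I') auto
  qed
  then have "AE \<omega> in M. \<forall>n h. \<not> (hist n \<omega> = h \<and> (\<forall>m. R (n + m) \<omega> = fst (h ! n)))"
    by (simp only: AE_all_countable) simp
  then show ?thesis using AE_regular
  proof eventually_elim
    case (elim \<omega>)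
    show ?case
    proof (rule ccontr)
      assume "\<not> (\<forall>J. \<exists>n. J \<le> R n \<omega>)"
      then obtain J where "\<And>n. R n \<omega> < J" by (auto simp: not_le)
      \<comment> \<open>A bounded sequence of naturals attains its maximum; by monotonicity R is
        constant from that time on.\<close>
      then obtain n where n: "\<And>m. R m \<omega> \<le> R n \<omega>"
        using ex_has_greatest_nat[of "\<lambda>_. True" 0 "\<lambda>m. R m \<omega>" J] by (auto simp: less_imp_le)
      have "R (n + m) \<omega> = fst (hist n \<omega> ! n)" for m
        using n[of "n + m"] regular_mono(1)[OF elim(2), of n "n + m"] by simp
      then show False using elim(1) by blast
    qed
  qed
qed

section \<open>The three conditions under convergence and under divergence\<close>

lemma AE_limit_count:
  "AE \<omega> in M. (limit_count R \<omega> < \<infinity> \<longleftrightarrow> \<not> (\<forall>J. \<exists>n. J \<le> R n \<omega>)) \<and>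
     (limit_count B \<omega> < \<infinity> \<longleftrightarrow> \<not> (\<forall>J. \<exists>n. J \<le> B n \<omega>))"
  using AE_regular
proof eventually_elim
  case (elim \<omega>)
  then show ?case
    using limit_count_less_infinity_iff[of R \<omega>] limit_count_less_infinity_iff[of B \<omega>] regular_Suc[OF elim] by blast
qed

lemma sets_limit_counts:
  "{\<omega> \<in> space M. limit_count R \<omega> < \<infinity>} \<in> sets M"
  "{\<omega> \<in> space M. limit_count R \<omega> < \<infinity> \<or> limit_count B \<omega> < \<infinity>} \<in> sets M"
  by (intro sets.sets_Collect_disj sets_limit_count R_measurable B_measurable)+

lemma summable_imp_red_finite:
  assumes sm: "summable (\<lambda>k. 1 / w k)"
  shows "0 < \<P>(\<omega> in M. limit_count R \<omega> < \<infinity>)"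
proof -
  have "0 < exp (- (real S * w r\<^sub>0 * (\<Sum>k. 1 / w (k + b\<^sub>0))))" by simp
  also note prob_never_red_ge[OF sm]
  also have "\<P>(\<omega> in M. \<forall>n. R n \<omega> = r\<^sub>0) \<le> \<P>(\<omega> in M. limit_count R \<omega> < \<infinity>)"
  proof (rule finite_measure_mono)
    have "limit_count R \<omega> < \<infinity>" if "\<forall>n. R n \<omega> = r\<^sub>0" for \<omega>
    proof -
      have "\<not> Suc r\<^sub>0 \<le> R n \<omega>" for n using that by simp
      then have "\<not> (\<forall>J. \<exists>n. J \<le> R n \<omega>)" by blast
      then show ?thesis using limit_count_less_infinity_iff[of R \<omega>] that by simp
    qed
    then show "{\<omega> \<in> space M. \<forall>n. R n \<omega> = r\<^sub>0} \<subseteq> {\<omega> \<in> space M. limit_count R \<omega> < \<infinity>}" by blast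
  qed (rule sets_limit_counts)
  finally show ?thesis .
qed

lemma summable_imp_fixation:
  assumes sm: "summable (\<lambda>k. 1 / w k)"
  shows "\<P>(\<omega> in M. limit_count R \<omega> < \<infinity> \<or> limit_count B \<omega> < \<infinity>) = 1"
proof -
  have "AE \<omega> in M. \<not> both_infinite R B \<omega>"
    using prob_both_infinite_eq_0[OF sm] sets_both_infinite by (subst (asm) prob_eq_0) auto
  then have "AE \<omega> in M. limit_count R \<omega> < \<infinity> \<or> limit_count B \<omega> < \<infinity>"
    using AE_limit_count AE_regular
  proof eventually_elim
    case (elim \<omega>)
    show ?case
    proof (rule ccontr)
      assume "\<not> (limit_count R \<omega> < \<infinity> \<or> limit_count B \<omega> < \<infinity>)"
      then have unb: "\<forall>J. \<exists>n. J \<le> R n \<omega>" "\<forall>J. \<exists>n. J \<le> B n \<omega>" using elim(2) by auto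
      have "both_infinite R B \<omega>"
        unfolding both_infinite_def
      proof
        fix J
        obtain n m where "J \<le> R n \<omega>" "J \<le> B m \<omega>" using unb by meson
        then show "\<exists>N. \<forall>n\<ge>N. J \<le> R n \<omega> \<and> J \<le> B n \<omega>"
          using regular_mono[OF elim(3)] by (intro exI[of _ "max n m"]) (meson max.bounded_iff order_trans)
      qed
      then show False using elim(1) by simp
    qed
  qed
  then show ?thesis using sets_limit_counts(2) by (simp add: prob_Collect_eq_1)
qed

text \<open>Exchanging the colours makes blue almost surely unbounded too, so the third condition
  fails with probability 0 instead of 1.\<close>

lemma not_summable_imp_unbounded:
  assumes ns: "\<not> summable (\<lambda>k. 1 / w k)"
  shows "\<P>(\<omega> in M. limit_count R \<omega> < \<infinity>) = 0"
    and "\<P>(\<omega> in M. limit_count R \<omega> < \<infinity> \<or> limit_count B \<omega> < \<infinity>) = 0"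
proof -
  interpret swapped: bounded_gpu M w \<sigma> b\<^sub>0 r\<^sub>0 B R S by (rule swap)
  have *: "AE \<omega> in M. \<not> limit_count R \<omega> < \<infinity> \<and> \<not> limit_count B \<omega> < \<infinity>"
    using AE_red_unbounded[OF ns] swapped.AE_red_unbounded[OF ns] AE_limit_count
    by eventually_elim blast
  have "AE \<omega> in M. \<not> limit_count R \<omega> < \<infinity>" using * by eventually_elim blast
  then show "\<P>(\<omega> in M. limit_count R \<omega> < \<infinity>) = 0"
    using sets_limit_counts(1) by (subst prob_eq_0) auto
  have "AE \<omega> in M. \<not> (limit_count R \<omega> < \<infinity> \<or> limit_count B \<omega> < \<infinity>)" using * by eventually_elim blast
  then show "\<P>(\<omega> in M. limit_count R \<omega> < \<infinity> \<or> limit_count B \<omega> < \<infinity>) = 0"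
    using sets_limit_counts(2) by (subst prob_eq_0) auto
qed

end

theorem theorem1p1:
  fixes M :: "'a measure" and w :: "nat \<Rightarrow> real" and \<sigma> :: "nat \<Rightarrow> nat"
    and r\<^sub>0 b\<^sub>0 :: nat and R B :: "nat \<Rightarrow> 'a \<Rightarrow> nat"
  assumes w_pos: "\<And>k. w k > 0" and w_mono: "mono w"
    and \<sigma>_pos: "\<And>n. n \<ge> 1 \<Longrightarrow> \<sigma> n > 0" and \<sigma>_bdd: "bdd_above (\<sigma> ` {1..})"
    and urn: "gpu_process M w \<sigma> r\<^sub>0 b\<^sub>0 R B"
  shows "(summable (\<lambda>k. 1 / w (Suc k)) \<longleftrightarrow>
            \<P>(\<omega> in M. limit_count R \<omega> < \<infinity>) > 0) \<and>
         (\<P>(\<omega> in M. limit_count R \<omega> < \<infinity>) > 0 \<longleftrightarrow>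
            \<P>(\<omega> in M. limit_count R \<omega> < \<infinity> \<or> limit_count B \<omega> < \<infinity>) = 1)"
proof -
  obtain S where S: "\<And>n. n \<ge> 1 \<Longrightarrow> \<sigma> n \<le> S" using \<sigma>_bdd by (auto simp: bdd_above_def)
  interpret gpu_process M w \<sigma> r\<^sub>0 b\<^sub>0 R B by (rule urn)
  interpret bounded_gpu M w \<sigma> r\<^sub>0 b\<^sub>0 R B S
    by unfold_locales (use w_pos w_mono \<sigma>_pos S in auto)
  \<comment> \<open>The stated series starts at k = 1, the internal one at 0.\<close>
  have iff: "summable (\<lambda>k. 1 / w (Suc k)) \<longleftrightarrow> summable (\<lambda>k. 1 / w k)"
    by (rule summable_Suc_iff)
  show ?thesis
  proof (cases "summable (\<lambda>k. 1 / w k)")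
    case True
    then show ?thesis
      using summable_imp_red_finite[OF True] summable_imp_fixation[OF True] by (simp add: iff)
  next
    case False
    then show ?thesis using not_summable_imp_unbounded[OF False] by (simp add: iff)
  qed
qed

end
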